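(* Let $E$ be a semi-Montel space over $\mathbb{K}$, $(T^{E}_{m},T^{\mathbb{K}}_{m})_{m\in M}$ a strong, consistent generator for $(\mathcal{FV},E)$ and let $U$ fix the topology in $\mathcal{FV}(\Omega)$. Then the restriction map \[ R_{U,E'}\colon S(\mathcal{FV}(\Omega)\varepsilon E)\to\mathcal{FV}_{E'}(U,E)_{lb},\; f\mapsto(T^{E}_{m}(f)(x))_{(m,x)\in U}, \] is surjective.
   Context: $\mathbb{K}=\mathbb{R}$ or $\mathbb{C}$. An lcHs is a non-trivial locally convex Hausdorff space over $\mathbb{K}$; a semi-Montel space is an lcHs in which every bounded set is relatively compact. The topology of $E$ is given by a directed system of seminorms $(p_{\alpha})_{\alpha\in\mathfrak{A}}$ (for $E=\mathbb{K}$: $\{|\cdot|\}$). For an lcHs $F$, $F'_{\kappa}$ is $F'$ with the topology of uniform convergence on absolutely convex compact subsets of $F$, and $F\varepsilon E:=L_{e}(F'_{\kappa},E)$ carries the topology of uniform convergence on equicontinuous subsets of $F'$. $\delta_x(f):=f(x)$. Weighted spaces: Let $\Omega$, $J$, $M$ be non-empty sets, $(\omega_m)_{m\in M}$ non-empty sets, and $\mathcal{V}=(\nu_{j,m})_{j\in J,m\in M}$ weight functions, i.e. $\nu_{j,m}\colon\omega_m\to[0,\infty)$ and for all $m\in M$, $x\in\omega_m$ there is $j\in J$ with $\nu_{j,m}(x)>0$. For $Y\in\{\mathbb{K},E\}$ let $T^{Y}_m\colon Y^{\Omega}\supset\operatorname{dom}T^{Y}_m\to Y^{\omega_m}$ be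 linear, $\operatorname{AP}(\Omega,Y)$ a linear subspace of $Y^{\Omega}$, $F(\Omega,Y):=\operatorname{AP}(\Omega,Y)\cap\bigcap_{m}\operatorname{dom}T^{Y}_m$ and \[ \mathcal{FV}(\Omega,Y):=\{f\in F(\Omega,Y)\;|\;\forall j,m,\alpha:\ |f|_{j,m,\alpha}:=\sup_{x\in\omega_m}p_\alpha(T^{Y}_m(f)(x))\nu_{j,m}(x)<\infty\} \] with these seminorms (index $\alpha$ omitted if $Y=\mathbb{K}$); $F(\Omega):=F(\Omega,\mathbb{K})$, $\mathcal{FV}(\Omega):=\mathcal{FV}(\Omega,\mathbb{K})$. It is a dom-space if it is Hausdorff, the system of seminorms is directed and, if $Y=\mathbb{K}$, all $\delta_x$, $x\in\Omega$, are continuous. $T^{\mathbb{K}}_{m,x}(f):=T^{\mathbb{K}}_m(f)(x)$. $(T^{E}_m,T^{\mathbb{K}}_m)_{m\in M}$ is a generator for $(\mathcal{FV},E)$ if $\mathcal{FV}(\Omega)$ and $\mathcal{FV}(\Omega,E)$ (built with the same $M,J,\omega_m,\mathcal{V}$) are dom-spaces. With $S(u)(x):=u(\delta_x)$, it is consistent if for all $u\in\mathcal{FV}(\Omega)\varepsilon E$: $S(u)\in F(\Omega,E)$ and $(T^{E}_mS(u))(x)=u(T^{\mathbb{K}}_{m,x})$ for all $m\in M,x\in\omega_m$ (then $S$ maps into $\mathcal{FV}(\Omega,E)$). It is strong if for all $e'\in E'$, $f\in\mathcal{FV}(\Omega,E)$: $e'\circ f\in F(\Omega)$ and $T^{\mathbb{K}}_m(e'\circ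 f)(x)=e'(T^{E}_m(f)(x))$ for all $m\in M$, $x\in\omega_m$. $U\subset\bigcup_{m\in M}(\{m\}\times\omega_m)$ fixes the topology in $\mathcal{FV}(\Omega)$ if for all $j\in J$, $m\in M$ there are $i\in J$, $k\in M$, $C>0$ with $|f|_{j,m}\le C\sup_{x\in\omega_k,(k,x)\in U}|T^{\mathbb{K}}_k(f)(x)|\nu_{i,k}(x)$ for all $f\in\mathcal{FV}(\Omega)$. $\mathcal{FV}_{E'}(U,E)$ is the space of functions $f\colon U\to E$ such that for every $e'\in E'$ there is $f_{e'}\in\mathcal{FV}(\Omega)$ with $T^{\mathbb{K}}_m(f_{e'})(x)=(e'\circ f)(m,x)$ for all $(m,x)\in U$; $\mathcal{FV}_{E'}(U,E)_{lb}$ consists of those $f\in\mathcal{FV}_{E'}(U,E)$ for which $\{f(k,x)\nu_{i,k}(x)\;|\;x\in\omega_k,(k,x)\in U\}$ is bounded in $E$ for all $i\in J$, $k\in M$. *)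

theory Defs
  imports "HOL-Analysis.Analysis" "HOL-Library.Function_Algebras"
begin

text \<open>
  Conventions.  The index sets \<open>\<Omega>\<close>, \<open>J\<close>, \<open>M\<close> and \<open>\<AA>\<close> are types (so they are non-empty); the sets
  \<open>\<omega> m\<close>, which may vary with \<open>m\<close>, are subsets of one type.  A space of functions is a subset
  of a function type, with pointwise operations.  A topological vector space that is not a whole
  type is represented by its topology; its carrier is the topspace.
\<close>

subsection \<open>The scalar field\<close>

class real_or_complex = real_normed_field +
  assumes isometric_real_or_complex:
    "(\<exists>h :: 'a \<Rightarrow> real. bij h \<and> (\<forall>x y. h (x + y) = h x + h y) \<and>
        (\<forall>x y. h (x * y) = h x * h y) \<and> (\<forall>x. norm (h x) = norm x)) \<or>
     (\<exists>h :: 'a \<Rightarrow> complex. bij h \<and> (\<forall>x y. h (x + y) = h x + h y) \<and>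
        (\<forall>x y. h (x * y) = h x * h y) \<and> (\<forall>x. norm (h x) = norm x))"

instance real :: real_or_complex
  by standard (intro disjI1 exI[of _ id], simp)

instance complex :: real_or_complex
  by standard (intro disjI2 exI[of _ id], simp)


subsection \<open>Locally convex spaces\<close>

definition fun_scale :: "('k \<Rightarrow> 'y \<Rightarrow> 'y) \<Rightarrow> 'k \<Rightarrow> ('x \<Rightarrow> 'y) \<Rightarrow> ('x \<Rightarrow> 'y)" where
  "fun_scale s c f = (\<lambda>x. s c (f x))"

definition seminorm ::
  "('k::real_normed_field \<Rightarrow> 'v::ab_group_add \<Rightarrow> 'v) \<Rightarrow> ('v \<Rightarrow> real) \<Rightarrow> bool" where
  "seminorm s q \<longleftrightarrow> (\<forall>x. 0 \<le> q x) \<and> (\<forall>x y. q (x + y) \<le> q x + q y) \<and>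
     (\<forall>c x. q (s c x) = norm c * q x)"

definition directed_seminorms :: "'v set \<Rightarrow> ('i \<Rightarrow> 'v \<Rightarrow> real) \<Rightarrow> bool" where
  "directed_seminorms V q \<longleftrightarrow>
     (\<forall>i k. \<exists>l. \<exists>C>0. \<forall>x\<in>V. max (q i x) (q k x) \<le> C * q l x)"

definition seminorm_topology ::
  "'v::ab_group_add set \<Rightarrow> 'i set \<Rightarrow> ('i \<Rightarrow> 'v \<Rightarrow> real) \<Rightarrow> 'v topology" where
  "seminorm_topology V I q =
     topology_generated_by {{y \<in> V. q i (y - x) < r} |x i r. x \<in> V \<and> i \<in> I \<and> 0 < r}"

definition bounded_in :: "('i \<Rightarrow> 'v \<Rightarrow> real) \<Rightarrow> 'v set \<Rightarrow> bool" where
  "bounded_in q B \<longleftrightarrow> (\<forall>i. bdd_above (q i ` B))"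

definition lcHs ::
  "('k::real_normed_field \<Rightarrow> 'e::ab_group_add \<Rightarrow> 'e) \<Rightarrow> ('a \<Rightarrow> 'e \<Rightarrow> real) \<Rightarrow> bool" where
  "lcHs s p \<longleftrightarrow> vector_space s \<and> (\<exists>x::'e. x \<noteq> 0) \<and> (\<forall>\<alpha>. seminorm s (p \<alpha>)) \<and>
     directed_seminorms UNIV p \<and> Hausdorff_space (seminorm_topology UNIV UNIV p)"

definition semi_Montel ::
  "('k::real_normed_field \<Rightarrow> 'e::ab_group_add \<Rightarrow> 'e) \<Rightarrow> ('a \<Rightarrow> 'e \<Rightarrow> real) \<Rightarrow> bool" where
  "semi_Montel s p \<longleftrightarrow> lcHs s p \<and>
     (\<forall>B. bounded_in p B \<longrightarrow>
        compactin (seminorm_topology UNIV UNIV p) (seminorm_topology UNIV UNIV p closure_of B))"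

definition abs_convex ::
  "('k::real_normed_field \<Rightarrow> 'v::ab_group_add \<Rightarrow> 'v) \<Rightarrow> 'v set \<Rightarrow> bool" where
  "abs_convex s K \<longleftrightarrow>
     (\<forall>x\<in>K. \<forall>y\<in>K. \<forall>a b. norm a + norm b \<le> 1 \<longrightarrow> s a x + s b y \<in> K)"

text \<open>
  Maps on a subset of a type are made unique by the value 0 outside of it, so that they again form
  a linear subspace of the function type.
\<close>

definition zero_outside :: "'v set \<Rightarrow> ('v \<Rightarrow> 'w::zero) \<Rightarrow> 'v \<Rightarrow> 'w" where
  "zero_outside V u = (\<lambda>x. if x \<in> V then u x else 0)"

definition cont_lin ::
  "('k \<Rightarrow> 'v::ab_group_add \<Rightarrow> 'v) \<Rightarrow> 'v topology \<Rightarrow>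
   ('k \<Rightarrow> 'w::ab_group_add \<Rightarrow> 'w) \<Rightarrow> 'w topology \<Rightarrow> ('v \<Rightarrow> 'w) set" where
  "cont_lin s X t Y = {u.
     (\<forall>x\<in>topspace X. \<forall>y\<in>topspace X. u (x + y) = u x + u y) \<and>
     (\<forall>c. \<forall>x\<in>topspace X. u (s c x) = t c (u x)) \<and>
     continuous_map X Y u \<and> (\<forall>x. x \<notin> topspace X \<longrightarrow> u x = 0)}"

definition dual ::
  "('k::real_normed_field \<Rightarrow> 'v::ab_group_add \<Rightarrow> 'v) \<Rightarrow> 'v topology \<Rightarrow> ('v \<Rightarrow> 'k) set" where
  "dual s X = cont_lin s X (*) euclidean"

text \<open>The inserted 0 only matters for the empty set.\<close>

definition kappa_topology ::
  "('k::real_normed_field \<Rightarrow> 'v::ab_group_add \<Rightarrow> 'v) \<Rightarrow> 'v topology \<Rightarrow> ('v \<Rightarrow> 'k) topology" where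
  "kappa_topology s X = seminorm_topology (dual s X) {K. abs_convex s K \<and> compactin X K}
     (\<lambda>K \<phi>. Sup (insert 0 ((\<lambda>x. norm (\<phi> x)) ` K)))"

definition eps_product ::
  "('k::real_normed_field \<Rightarrow> 'v::ab_group_add \<Rightarrow> 'v) \<Rightarrow> 'v topology \<Rightarrow>
   ('k \<Rightarrow> 'e::ab_group_add \<Rightarrow> 'e) \<Rightarrow> 'e topology \<Rightarrow> (('v \<Rightarrow> 'k) \<Rightarrow> 'e) set" where
  "eps_product s X t Y = cont_lin (fun_scale (*)) (kappa_topology s X) t Y"


subsection \<open>Weighted spaces of functions\<close>

text \<open>
  The operators \<open>T\<^sub>m\<close> map \<open>domT m\<close> to functions on \<open>\<omega> m\<close>; the values of \<open>opT D m f\<close> outside of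
  \<open>\<omega> m\<close> are irrelevant.
\<close>

record ('o, 'm, 'w, 'y) operators =
  AP :: "('o \<Rightarrow> 'y) set"
  domT :: "'m \<Rightarrow> ('o \<Rightarrow> 'y) set"
  opT :: "'m \<Rightarrow> ('o \<Rightarrow> 'y) \<Rightarrow> 'w \<Rightarrow> 'y"

definition weight_functions :: "('m \<Rightarrow> 'w set) \<Rightarrow> ('j \<Rightarrow> 'm \<Rightarrow> 'w \<Rightarrow> real) \<Rightarrow> bool" where
  "weight_functions \<omega> \<nu> \<longleftrightarrow> (\<forall>m. \<omega> m \<noteq> {}) \<and> (\<forall>j m. \<forall>x\<in>\<omega> m. 0 \<le> \<nu> j m x) \<and>
     (\<forall>m. \<forall>x\<in>\<omega> m. \<exists>j. 0 < \<nu> j m x)"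

definition linear_operators ::
  "('k::real_normed_field \<Rightarrow> 'y::ab_group_add \<Rightarrow> 'y) \<Rightarrow> ('m \<Rightarrow> 'w set) \<Rightarrow>
   ('o, 'm, 'w, 'y) operators \<Rightarrow> bool" where
  "linear_operators s \<omega> D \<longleftrightarrow>
     module.subspace (fun_scale s) (AP D) \<and>
     (\<forall>m. module.subspace (fun_scale s) (domT D m) \<and>
       (\<forall>f\<in>domT D m. \<forall>g\<in>domT D m. \<forall>x\<in>\<omega> m. opT D m (f + g) x = opT D m f x + opT D m g x) \<and>
       (\<forall>c. \<forall>f\<in>domT D m. \<forall>x\<in>\<omega> m. opT D m (fun_scale s c f) x = s c (opT D m f x)))"

definition F_space :: "('o, 'm, 'w, 'y) operators \<Rightarrow> ('o \<Rightarrow> 'y) set" where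
  "F_space D = AP D \<inter> (\<Inter>m. domT D m)"

definition FV_space ::
  "('a \<Rightarrow> 'y \<Rightarrow> real) \<Rightarrow> ('m \<Rightarrow> 'w set) \<Rightarrow> ('j \<Rightarrow> 'm \<Rightarrow> 'w \<Rightarrow> real) \<Rightarrow>
   ('o, 'm, 'w, 'y) operators \<Rightarrow> ('o \<Rightarrow> 'y) set" where
  "FV_space p \<omega> \<nu> D = {f \<in> F_space D.
     \<forall>j m \<alpha>. bdd_above ((\<lambda>x. p \<alpha> (opT D m f x) * \<nu> j m x) ` \<omega> m)}"

definition FV_seminorm ::
  "('a \<Rightarrow> 'y \<Rightarrow> real) \<Rightarrow> ('m \<Rightarrow> 'w set) \<Rightarrow> ('j \<Rightarrow> 'm \<Rightarrow> 'w \<Rightarrow> real) \<Rightarrow>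
   ('o, 'm, 'w, 'y) operators \<Rightarrow> 'j \<times> 'm \<times> 'a \<Rightarrow> ('o \<Rightarrow> 'y) \<Rightarrow> real" where
  "FV_seminorm p \<omega> \<nu> D = (\<lambda>(j, m, \<alpha>) f. SUP x\<in>\<omega> m. p \<alpha> (opT D m f x) * \<nu> j m x)"

definition FV_topology ::
  "('a \<Rightarrow> 'y::ab_group_add \<Rightarrow> real) \<Rightarrow> ('m \<Rightarrow> 'w set) \<Rightarrow> ('j \<Rightarrow> 'm \<Rightarrow> 'w \<Rightarrow> real) \<Rightarrow>
   ('o, 'm, 'w, 'y) operators \<Rightarrow> ('o \<Rightarrow> 'y) topology" where
  "FV_topology p \<omega> \<nu> D = seminorm_topology (FV_space p \<omega> \<nu> D) UNIV (FV_seminorm p \<omega> \<nu> D)"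

abbreviation scalar_norm :: "unit \<Rightarrow> 'k::real_normed_field \<Rightarrow> real" where
  "scalar_norm \<equiv> (\<lambda>_. norm)"

definition dom_space ::
  "('a \<Rightarrow> 'y::ab_group_add \<Rightarrow> real) \<Rightarrow> ('m \<Rightarrow> 'w set) \<Rightarrow> ('j \<Rightarrow> 'm \<Rightarrow> 'w \<Rightarrow> real) \<Rightarrow>
   ('o, 'm, 'w, 'y) operators \<Rightarrow> bool" where
  "dom_space p \<omega> \<nu> D \<longleftrightarrow> Hausdorff_space (FV_topology p \<omega> \<nu> D) \<and>
     directed_seminorms (FV_space p \<omega> \<nu> D) (FV_seminorm p \<omega> \<nu> D)"

definition scalar_dom_space ::
  "('m \<Rightarrow> 'w set) \<Rightarrow> ('j \<Rightarrow> 'm \<Rightarrow> 'w \<Rightarrow> real) \<Rightarrow>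
   ('o, 'm, 'w, 'k::real_normed_field) operators \<Rightarrow> bool" where
  "scalar_dom_space \<omega> \<nu> D \<longleftrightarrow> dom_space scalar_norm \<omega> \<nu> D \<and>
     (\<forall>x. continuous_map (FV_topology scalar_norm \<omega> \<nu> D) euclidean (\<lambda>f. f x))"

definition generator ::
  "('k::real_normed_field \<Rightarrow> 'e::ab_group_add \<Rightarrow> 'e) \<Rightarrow> ('a \<Rightarrow> 'e \<Rightarrow> real) \<Rightarrow>
   ('m \<Rightarrow> 'w set) \<Rightarrow> ('j \<Rightarrow> 'm \<Rightarrow> 'w \<Rightarrow> real) \<Rightarrow>
   ('o, 'm, 'w, 'e) operators \<Rightarrow> ('o, 'm, 'w, 'k) operators \<Rightarrow> bool" where
  "generator s p \<omega> \<nu> DE DK \<longleftrightarrow> weight_functions \<omega> \<nu> \<and>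
     linear_operators s \<omega> DE \<and> linear_operators (*) \<omega> DK \<and>
     dom_space p \<omega> \<nu> DE \<and> scalar_dom_space \<omega> \<nu> DK"

definition FV_eps ::
  "('k::real_normed_field \<Rightarrow> 'e::ab_group_add \<Rightarrow> 'e) \<Rightarrow> ('a \<Rightarrow> 'e \<Rightarrow> real) \<Rightarrow>
   ('m \<Rightarrow> 'w set) \<Rightarrow> ('j \<Rightarrow> 'm \<Rightarrow> 'w \<Rightarrow> real) \<Rightarrow>
   ('o, 'm, 'w, 'k) operators \<Rightarrow> ((('o \<Rightarrow> 'k) \<Rightarrow> 'k) \<Rightarrow> 'e) set" where
  "FV_eps s p \<omega> \<nu> DK = eps_product (fun_scale (*)) (FV_topology scalar_norm \<omega> \<nu> DK)
     s (seminorm_topology UNIV UNIV p)"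

definition delta ::
  "('m \<Rightarrow> 'w set) \<Rightarrow> ('j \<Rightarrow> 'm \<Rightarrow> 'w \<Rightarrow> real) \<Rightarrow>
   ('o, 'm, 'w, 'k::real_normed_field) operators \<Rightarrow> 'o \<Rightarrow> ('o \<Rightarrow> 'k) \<Rightarrow> 'k" where
  "delta \<omega> \<nu> DK x = zero_outside (FV_space scalar_norm \<omega> \<nu> DK) (\<lambda>f. f x)"

definition op_functional ::
  "('m \<Rightarrow> 'w set) \<Rightarrow> ('j \<Rightarrow> 'm \<Rightarrow> 'w \<Rightarrow> real) \<Rightarrow>
   ('o, 'm, 'w, 'k::real_normed_field) operators \<Rightarrow> 'm \<Rightarrow> 'w \<Rightarrow> ('o \<Rightarrow> 'k) \<Rightarrow> 'k" where
  "op_functional \<omega> \<nu> DK m x =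
     zero_outside (FV_space scalar_norm \<omega> \<nu> DK) (\<lambda>f. opT DK m f x)"

definition S_map ::
  "('m \<Rightarrow> 'w set) \<Rightarrow> ('j \<Rightarrow> 'm \<Rightarrow> 'w \<Rightarrow> real) \<Rightarrow>
   ('o, 'm, 'w, 'k::real_normed_field) operators \<Rightarrow> ((('o \<Rightarrow> 'k) \<Rightarrow> 'k) \<Rightarrow> 'e) \<Rightarrow> 'o \<Rightarrow> 'e" where
  "S_map \<omega> \<nu> DK u = (\<lambda>x. u (delta \<omega> \<nu> DK x))"

definition consistent ::
  "('k::real_normed_field \<Rightarrow> 'e::ab_group_add \<Rightarrow> 'e) \<Rightarrow> ('a \<Rightarrow> 'e \<Rightarrow> real) \<Rightarrow>
   ('m \<Rightarrow> 'w set) \<Rightarrow> ('j \<Rightarrow> 'm \<Rightarrow> 'w \<Rightarrow> real) \<Rightarrow>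
   ('o, 'm, 'w, 'e) operators \<Rightarrow> ('o, 'm, 'w, 'k) operators \<Rightarrow> bool" where
  "consistent s p \<omega> \<nu> DE DK \<longleftrightarrow> (\<forall>u \<in> FV_eps s p \<omega> \<nu> DK.
     S_map \<omega> \<nu> DK u \<in> F_space DE \<and>
     (\<forall>m. \<forall>x\<in>\<omega> m. opT DE m (S_map \<omega> \<nu> DK u) x = u (op_functional \<omega> \<nu> DK m x)))"

definition strong ::
  "('k::real_normed_field \<Rightarrow> 'e::ab_group_add \<Rightarrow> 'e) \<Rightarrow> ('a \<Rightarrow> 'e \<Rightarrow> real) \<Rightarrow>
   ('m \<Rightarrow> 'w set) \<Rightarrow> ('j \<Rightarrow> 'm \<Rightarrow> 'w \<Rightarrow> real) \<Rightarrow>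
   ('o, 'm, 'w, 'e) operators \<Rightarrow> ('o, 'm, 'w, 'k) operators \<Rightarrow> bool" where
  "strong s p \<omega> \<nu> DE DK \<longleftrightarrow>
     (\<forall>e' \<in> dual s (seminorm_topology UNIV UNIV p). \<forall>f \<in> FV_space p \<omega> \<nu> DE.
        e' \<circ> f \<in> F_space DK \<and>
        (\<forall>m. \<forall>x\<in>\<omega> m. opT DK m (e' \<circ> f) x = e' (opT DE m f x)))"

text \<open>
  The supremum over the possibly empty slice of \<open>U\<close> is taken in \<open>[0, \<infinity>)\<close>, hence the inserted 0.
\<close>

definition fixes_topology ::
  "('m \<Rightarrow> 'w set) \<Rightarrow> ('j \<Rightarrow> 'm \<Rightarrow> 'w \<Rightarrow> real) \<Rightarrow>
   ('o, 'm, 'w, 'k::real_normed_field) operators \<Rightarrow> ('m \<times> 'w) set \<Rightarrow> bool" where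
  "fixes_topology \<omega> \<nu> DK U \<longleftrightarrow> U \<subseteq> Sigma UNIV \<omega> \<and>
     (\<forall>j m. \<exists>i k. \<exists>C>0. \<forall>f \<in> FV_space scalar_norm \<omega> \<nu> DK.
        FV_seminorm scalar_norm \<omega> \<nu> DK (j, m, ()) f \<le>
          C * Sup (insert 0 ((\<lambda>x. norm (opT DK k f x) * \<nu> i k x) ` {x \<in> \<omega> k. (k, x) \<in> U})))"

definition FV_dual_space ::
  "('k::real_normed_field \<Rightarrow> 'e::ab_group_add \<Rightarrow> 'e) \<Rightarrow> ('a \<Rightarrow> 'e \<Rightarrow> real) \<Rightarrow>
   ('m \<Rightarrow> 'w set) \<Rightarrow> ('j \<Rightarrow> 'm \<Rightarrow> 'w \<Rightarrow> real) \<Rightarrow>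
   ('o, 'm, 'w, 'k) operators \<Rightarrow> ('m \<times> 'w) set \<Rightarrow> ('m \<times> 'w \<Rightarrow> 'e) set" where
  "FV_dual_space s p \<omega> \<nu> DK U = {f \<in> extensional U.
     \<forall>e' \<in> dual s (seminorm_topology UNIV UNIV p). \<exists>g \<in> FV_space scalar_norm \<omega> \<nu> DK.
       \<forall>(m, x) \<in> U. opT DK m g x = e' (f (m, x))}"

definition FV_dual_space_lb ::
  "('k::real_normed_field \<Rightarrow> 'e::ab_group_add \<Rightarrow> 'e) \<Rightarrow> ('a \<Rightarrow> 'e \<Rightarrow> real) \<Rightarrow>
   ('m \<Rightarrow> 'w set) \<Rightarrow> ('j \<Rightarrow> 'm \<Rightarrow> 'w \<Rightarrow> real) \<Rightarrow>
   ('o, 'm, 'w, 'k) operators \<Rightarrow> ('m \<times> 'w) set \<Rightarrow> ('m \<times> 'w \<Rightarrow> 'e) set" where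
  "FV_dual_space_lb s p \<omega> \<nu> DK U = {f \<in> FV_dual_space s p \<omega> \<nu> DK U.
     \<forall>i k. bounded_in p {s (of_real (\<nu> i k x)) (f (k, x)) |x. x \<in> \<omega> k \<and> (k, x) \<in> U}}"

definition restriction_map ::
  "('o, 'm, 'w, 'e) operators \<Rightarrow> ('m \<times> 'w) set \<Rightarrow> ('o \<Rightarrow> 'e) \<Rightarrow> 'm \<times> 'w \<Rightarrow> 'e" where
  "restriction_map DE U f = restrict (\<lambda>(m, x). opT DE m f x) U"

end

theory Submission
  imports Defs
begin

text \<open>
  Given \<open>f\<close> on the right-hand side, let \<open>G e'\<close> be the unique element of \<open>\<F>\<V>(\<Omega>)\<close> that
  extends \<open>e' \<circ> f\<close>; it is unique because \<open>U\<close> fixes the topology.  The required \<open>u\<close> is the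
  transpose of \<open>G\<close>.  As \<open>f\<close> is weighted bounded and \<open>E\<close> is semi-Montel, each seminorm of
  \<open>G e'\<close> is bounded by the supremum of \<open>|e'|\<close> over a compact absolutely convex set
  \<open>K = {z. \<forall>\<alpha>. p \<alpha> z \<le> c \<alpha>}\<close>.  Two consequences follow.  First, for \<open>y\<close> in the dual of
  \<open>\<F>\<V>(\<Omega>)\<close> the functional \<open>e' \<mapsto> y (G e')\<close> is evaluation at a point \<open>u y\<close> of a multiple of
  \<open>K\<close>: a least squares argument solves finitely many equations in \<open>K\<close>, and compactness solves
  all of them at once.  Secondly, \<open>G\<close> maps the polar of each \<open>p \<alpha>\<close>, which is compact for
  pointwise convergence, onto a compact set \<open>L\<close>, and by Hahn--Banach \<open>p \<alpha> (u y)\<close> is at most the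
  supremum of \<open>|y|\<close> over \<open>L\<close>; hence \<open>u\<close> is continuous on the dual with the topology \<open>\<kappa>\<close>.
\<close>


subsection \<open>The real and complex fields\<close>

text \<open>
  Real part and conjugate, by polarization and from the trace, in terms that make sense over both
  fields.
\<close>

definition re_part :: "'k::real_or_complex \<Rightarrow> real" where
  "re_part x = ((norm (1 + x))\<^sup>2 - (norm (1 - x))\<^sup>2) / 4"

definition conj_part :: "'k::real_or_complex \<Rightarrow> 'k" where
  "conj_part x = of_real (2 * re_part x) - x"

text \<open>The isometries in \<open>real_or_complex\<close> are assumed only additive and
  multiplicative. Such a map fixes the rationals by algebra and the remaining reals by continuity,
  since the rationals are dense.\<close>

lemma isometric_hom_of_real:
  fixes h :: "'a::real_normed_field \<Rightarrow> 'b::real_normed_field"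
  assumes add: "\<And>x y. h (x + y) = h x + h y" and mult: "\<And>x y. h (x * y) = h x * h y"
    and iso: "\<And>x. norm (h x) = norm x"
  shows "h (of_real r) = of_real r"
proof -
  interpret additive h by standard (rule add)
  have lip: "dist (h x) (h y) = dist x y" for x y
    by (simp add: dist_norm iso flip: diff)
  have cont: "continuous_on UNIV h"
    unfolding continuous_on_iff lip by blast
  have "h 1 * h 1 = h 1" "h 1 \<noteq> 0"
    using mult[of 1 1] iso[of 1] by auto
  then have one: "h 1 = 1" by simp
  have nat: "h (of_nat n) = of_nat n" for n
    by (induction n) (simp_all add: zero add one)
  have int: "h (of_int i) = of_int i" for i
    by (cases i rule: int_cases2) (simp_all add: nat minus)
  have rat: "h (of_real q) = of_real q" if "q \<in> \<rat>" for q
  proof -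
    obtain a b where "b > 0" "coprime a b" and q: "q = of_int a / of_int b"
      using \<open>q \<in> \<rat>\<close> by (elim Rats_cases')
    then have "b \<noteq> 0" by simp
    have "of_real q * of_int b = (of_int a :: 'a)"
      using q \<open>b \<noteq> 0\<close> by (simp add: of_real_divide)
    then have "h (of_real q) * of_int b = (of_int a :: 'b)"
      by (metis mult int)
    then have "h (of_real q) = of_int a / of_int b"
      using \<open>b \<noteq> 0\<close> by (simp only: nonzero_eq_divide_eq of_int_eq_0_iff not_False_eq_True)
    then show ?thesis by (simp add: q of_real_divide)
  qed
  have "h (of_real r) - of_real r = 0"
  proof (rule continuous_constant_on_closure[where S = \<rat> and f = "\<lambda>r. h (of_real r) - of_real r"])
    show "continuous_on (closure \<rat>) (\<lambda>r. h (of_real r) - of_real r)"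
      by (intro continuous_intros continuous_on_compose2[OF cont]) auto
  qed (simp_all add: rat Rats_closure_real)
  then show ?thesis by simp
qed

text \<open>Each claim is transported along the isometry \<open>h\<close>: there
  \<open>re_part\<close> becomes the identity or \<open>Re\<close>, and \<open>conj_part\<close> the
  identity or \<open>cnj\<close>. Injectivity of \<open>h\<close> carries back the identity
  \<open>conj_mult_self\<close> between scalars.\<close>

lemma conjugation:
  fixes x y :: "'k::real_or_complex"
  shows re_part_add: "re_part (x + y) = re_part x + re_part y"
    and re_part_of_real: "re_part (of_real r * x) = r * re_part x"
    and re_part_le_norm: "re_part x \<le> norm x"
    and norm_conj: "norm (conj_part x) = norm x"
    and conj_mult_self: "conj_part x * x = of_real ((norm x)\<^sup>2)"
    and norm_add_power2: "(norm (x + y))\<^sup>2 = (norm x)\<^sup>2 + 2 * re_part (conj_part x * y) + (norm y)\<^sup>2"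
proof -
  have "re_part (x + y) = re_part x + re_part y \<and> re_part (of_real r * x) = r * re_part x \<and>
    re_part x \<le> norm x \<and> norm (conj_part x) = norm x \<and> conj_part x * x = of_real ((norm x)\<^sup>2) \<and>
    (norm (x + y))\<^sup>2 = (norm x)\<^sup>2 + 2 * re_part (conj_part x * y) + (norm y)\<^sup>2"
    using isometric_real_or_complex[where 'a = 'k]
  proof (elim disjE exE conjE)
    fix h :: "'k \<Rightarrow> real"
    assume "bij h" and add: "\<forall>x y. h (x + y) = h x + h y"
      and mult: "\<forall>x y. h (x * y) = h x * h y" and iso: "\<forall>x. norm (h x) = norm x"
    interpret additive h by standard (simp add: add)
    have real: "h (of_real r) = r" for r
      using isometric_hom_of_real[of h r] add mult iso by simp
    have one: "h 1 = 1" and two: "h 2 = 2" using real[of 1] real[of 2] by simp_all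
    have re: "re_part x = h x" for x
      unfolding re_part_def iso[rule_format, symmetric]
      by (simp add: add diff one power2_eq_square algebra_simps)
    have inj: "x = y" if "h x = h y" for x y
      using that \<open>bij h\<close> by (auto simp: bij_def inj_def)
    show ?thesis
      unfolding re conj_part_def iso[rule_format, symmetric]
      by (auto simp: add mult real two diff power2_eq_square algebra_simps intro!: inj)
  next
    fix h :: "'k \<Rightarrow> complex"
    assume "bij h" and add: "\<forall>x y. h (x + y) = h x + h y"
      and mult: "\<forall>x y. h (x * y) = h x * h y" and iso: "\<forall>x. norm (h x) = norm x"
    interpret additive h by standard (simp add: add)
    have real: "h (of_real r) = of_real r" for r
      using isometric_hom_of_real[of h r] add mult iso by simp
    have one: "h 1 = 1" and two: "h 2 = 2" using real[of 1] real[of 2] by simp_all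
    have re: "re_part x = Re (h x)" for x
      unfolding re_part_def iso[rule_format, symmetric]
      by (simp add: add diff one cmod_power2) (simp add: power2_eq_square algebra_simps)
    have inj: "x = y" if "h x = h y" for x y
      using that \<open>bij h\<close> by (auto simp: bij_def inj_def)
    have cnj: "h (conj_part x) = cnj (h x)" for x
      by (simp add: conj_part_def re diff mult real two complex_eq_iff)
    show ?thesis
      unfolding re iso[rule_format, symmetric]
      by (auto simp: add mult real cnj complex_Re_le_cmod complex_eq_iff cmod_power2
          simp flip: of_real_power of_real_add of_real_mult
          intro!: inj) (simp_all add: power2_eq_square algebra_simps)
  qed
  then show "re_part (x + y) = re_part x + re_part y" "re_part (of_real r * x) = r * re_part x"
    "re_part x \<le> norm x" "norm (conj_part x) = norm x" "conj_part x * x = of_real ((norm x)\<^sup>2)"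
    "(norm (x + y))\<^sup>2 = (norm x)\<^sup>2 + 2 * re_part (conj_part x * y) + (norm y)\<^sup>2"
    by blast+
qed

text \<open>The scalar field is a real Hilbert space of dimension one or two, on which every
  real-linear functional is an inner product. This supplies the values of the scalar functional
  built from a real one in \<open>hahn_banach_seminorm\<close>.\<close>

lemma re_part_representation:
  fixes r :: "'k::real_or_complex \<Rightarrow> real"
  assumes radd: "\<And>x y. r (x + y) = r x + r y" and rscale: "\<And>a x. r (of_real a * x) = a * r x"
  obtains k where "\<And>c. r c = re_part (c * k)"
  using isometric_real_or_complex[where 'a = 'k]
proof (elim disjE exE conjE)
  fix h :: "'k \<Rightarrow> real"
  assume "bij h" and add: "\<forall>x y. h (x + y) = h x + h y"
    and mult: "\<forall>x y. h (x * y) = h x * h y" and iso: "\<forall>x. norm (h x) = norm x"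
  have real: "h (of_real r) = r" for r
    using isometric_hom_of_real[of h r] add mult iso by simp
  have inj: "x = y" if "h x = h y" for x y
    using that \<open>bij h\<close> by (auto simp: bij_def inj_def)
  have id: "c = of_real (h c)" for c
    by (rule inj) (simp add: real)
  have "re_part (of_real a :: 'k) = a" for a
    using re_part_of_real[of a "1 :: 'k"] by (simp add: re_part_def)
  then have "r c = re_part (c * of_real (r 1))" for c
    using rscale[of "h c" 1] id[of c] by (metis mult.right_neutral of_real_mult)
  then show ?thesis by (rule that)
next
  fix h :: "'k \<Rightarrow> complex"
  assume "bij h" and add: "\<forall>x y. h (x + y) = h x + h y"
    and mult: "\<forall>x y. h (x * y) = h x * h y" and iso: "\<forall>x. norm (h x) = norm x"
  have real: "h (of_real r) = of_real r" for r
    using isometric_hom_of_real[of h r] add mult iso by simp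
  have inj: "x = y" if "h x = h y" for x y
    using that \<open>bij h\<close> by (auto simp: bij_def inj_def)
  \<comment> \<open>\<open>j\<close> is the imaginary unit of \<open>'k\<close>; together with 1 it
    forms a basis over the reals.\<close>
  obtain j where j: "h j = \<i>"
    using \<open>bij h\<close> by (metis bij_pointE)
  have id: "c = of_real (Re (h c)) * 1 + of_real (Im (h c)) * j" for c
    by (rule inj) (simp add: real add mult j complex_eq_iff)
  have jj: "j * j = - 1"
  proof -
    have "h (j * j + 1) = h 0"
      using real[of 1] real[of 0] by (simp add: add mult j)
    then show ?thesis using inj eq_neg_iff_add_eq_0 by blast
  qed
  have "norm j = 1" using iso[rule_format, of j] j by simp
  have re1: "re_part (1::'k) = 1"
    by (simp add: re_part_def)
  have "re_part j = 0"
  proof -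
    interpret additive h by standard (simp add: add)
    have "norm (1 + j) = norm (h (1 + j))" "norm (1 - j) = norm (h (1 - j))"
      by (simp_all add: iso)
    then show ?thesis
      using real[of 1] by (simp add: re_part_def add diff j cmod_def)
  qed
  \<comment> \<open>The choice comes from Re((a + b i)(r(1) - r(i) i)) = a r(1) + b r(i).\<close>
  define k where "k = of_real (r 1) * 1 + of_real (- r j) * j"
  have "re_part (c * k) = r c" for c
  proof -
    have "c * k = of_real (Re (h c) * r 1 + Im (h c) * r j) * 1 + of_real (Im (h c) * r 1 - Re (h c) * r j) * j"
    proof -
      have "(of_real a * 1 + of_real b * j) * k = of_real (a * r 1 + b * r j) * 1 + of_real (b * r 1 - a * r j) * j"
        for a b
      proof -
        have "(of_real a * 1 + of_real b * j) * k =
            of_real (a * r 1) + of_real (b * r 1 - a * r j) * j - of_real (b * r j) * (j * j)"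
          unfolding k_def by (simp add: algebra_simps)
        then show ?thesis by (simp add: jj)
      qed
      then show ?thesis using id[of c] by metis
    qed
    then have "re_part (c * k) = Re (h c) * r 1 + Im (h c) * r j"
      by (simp add: re_part_add re_part_of_real re1 \<open>re_part j = 0\<close> del: mult_1_right of_real_add of_real_diff)
    also have "\<dots> = r c"
      using arg_cong[OF id[of c], of r] by (simp only: radd rscale)
    finally show ?thesis .
  qed
  then show ?thesis by (metis that)
qed

text \<open>For nonzero \<open>x\<close> the multiplier is the conjugate divided by the norm. It
  turns estimates of real parts into estimates of norms on sets stable under unit scalars.\<close>

lemma unit_multiple_re_part:
  fixes x :: "'k::real_or_complex"
  obtains c where "norm c = 1" "re_part (c * x) = norm x"
proof (cases "x = 0")
  case True
  then show ?thesis using that[of 1] by (simp add: re_part_def)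
next
  case False
  have "re_part (of_real a :: 'k) = a" for a
    using re_part_of_real[of a "1 :: 'k"] by (simp add: re_part_def)
  moreover have "of_real (inverse (norm x)) * conj_part x * x = of_real (norm x)"
    using False
    by (simp add: mult.assoc conj_mult_self power2_eq_square del: of_real_inverse flip: of_real_mult)
  moreover have "norm (of_real (inverse (norm x)) * conj_part x) = 1"
    using False unfolding norm_mult norm_conj norm_of_real by simp
  ultimately show ?thesis
    using that by metis
qed

text \<open>The unit multiplier for \<open>k - l\<close> turns the hypothesis into
  \<open>norm (k - l) = 0\<close>.\<close>

lemma re_part_eqI:
  fixes k l :: "'k::real_or_complex"
  assumes "\<And>c. re_part (c * k) = re_part (c * l)"
  shows "k = l"
proof -
  obtain c where c: "re_part (c * (k - l)) = norm (k - l)"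
    using unit_multiple_re_part by blast
  have "re_part (c * k) = re_part (c * (k - l)) + re_part (c * l)"
    by (simp add: algebra_simps flip: re_part_add)
  then show ?thesis using assms c by simp
qed

text \<open>The inverse of \<open>h\<close> is again an isometry, so the ball is a continuous image
  of a compact ball in the reals or the complex numbers. This feeds Tychonoff's theorem in
  \<open>compact_polar\<close>.\<close>

lemma compact_cball_real_or_complex:
  fixes x :: "'k::real_or_complex"
  shows "compact (cball 0 r :: 'k set)"
proof -
  have *: "compact (cball 0 r :: 'k set)"
    if h: "bij h" "\<forall>x y. h (x + y) = h x + h y" "\<forall>x. norm (h x) = norm x"
    for h :: "'k \<Rightarrow> 'b::euclidean_space"
  proof -
    interpret additive h by standard (simp add: h)
    have lip: "dist (h x) (h y) = dist x y" for x y
      by (simp add: dist_norm h flip: diff)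
    have inv: "h (inv h y) = y" for y
      using h(1) by (simp add: bij_is_surj surj_f_inv_f)
    have "dist (inv h x) (inv h y) = dist x y" for x y
      by (metis lip inv)
    then have "continuous_on UNIV (inv h)"
      unfolding continuous_on_iff by auto
    then have "compact (inv h ` cball 0 r)"
      by (meson compact_cball compact_continuous_image continuous_on_subset subset_UNIV)
    moreover have "inv h ` cball 0 r = cball 0 r"
    proof -
      have "norm (inv h y) = norm y" for y
        by (metis h(3) inv)
      moreover have "inv h (h x) = x" for x
        using h(1) by (simp add: bij_is_inj)
      ultimately show ?thesis
        by (intro bij_betw_imp_surj_on[of "inv h"] bij_betw_byWitness[where f' = h]) (auto simp: h(3) inv)
    qed
    ultimately show ?thesis by simp
  qed
  show ?thesis
    using isometric_real_or_complex[where 'a = 'k] by (elim disjE exE conjE) (blast intro: *)+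
qed


subsection \<open>Seminorm topologies\<close>

text \<open>The axioms are relative to a carrier \<open>V\<close> and an index set \<open>I\<close>,
  so that one theory covers \<open>E\<close>, the weighted space, and its dual with the topology
  \<kappa>, whose seminorms are indexed by compact absolutely convex sets.\<close>

locale seminorm_family = vector_space s
  for s :: "'k::real_normed_field \<Rightarrow> 'v::ab_group_add \<Rightarrow> 'v" +
  fixes V :: "'v set" and I :: "'i set" and q :: "'i \<Rightarrow> 'v \<Rightarrow> real"
  assumes subspace: "subspace V" and index_nonempty: "I \<noteq> {}"
    and q_nonneg: "i \<in> I \<Longrightarrow> x \<in> V \<Longrightarrow> 0 \<le> q i x"
    and q_add: "i \<in> I \<Longrightarrow> x \<in> V \<Longrightarrow> y \<in> V \<Longrightarrow> q i (x + y) \<le> q i x + q i y"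
    and q_scale: "i \<in> I \<Longrightarrow> x \<in> V \<Longrightarrow> q i (s c x) = norm c * q i x"
begin

abbreviation "\<T> \<equiv> seminorm_topology V I q"

lemma closed_ops: "0 \<in> V" "x \<in> V \<Longrightarrow> y \<in> V \<Longrightarrow> x + y \<in> V" "x \<in> V \<Longrightarrow> s c x \<in> V"
  "x \<in> V \<Longrightarrow> y \<in> V \<Longrightarrow> x - y \<in> V"
  using subspace by (auto simp: subspace_0 subspace_add subspace_scale subspace_diff)

lemma q_zero: "i \<in> I \<Longrightarrow> q i 0 = 0"
  using q_scale[of i 0 0] closed_ops(1) by simp

lemma q_minus_commute: "i \<in> I \<Longrightarrow> x \<in> V \<Longrightarrow> y \<in> V \<Longrightarrow> q i (x - y) = q i (y - x)"
  using q_scale[of i "x - y" "- 1"] closed_ops(4) by simp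

lemma q_triangle: "i \<in> I \<Longrightarrow> x \<in> V \<Longrightarrow> y \<in> V \<Longrightarrow> z \<in> V \<Longrightarrow> q i (x - z) \<le> q i (x - y) + q i (y - z)"
  using q_add[of i "x - y" "y - z"] closed_ops(4) by simp

lemma topspace_seminorm_topology: "topspace \<T> = V"
proof -
  obtain i where "i \<in> I" using index_nonempty by blast
  then have "x \<in> \<Union>{{y \<in> V. q i (y - x) < r} |x i r. x \<in> V \<and> i \<in> I \<and> 0 < r}" if "x \<in> V" for x
    using that by (intro UnionI[of "{y \<in> V. q i (y - x) < 1}"] CollectI exI[of _ x] exI[of _ i] exI[of _ 1])
      (auto simp: q_zero)
  then show ?thesis
    unfolding seminorm_topology_def topology_generated_by_topspace by blast
qed

lemma openin_ball:
  assumes "x \<in> V" "i \<in> I"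
  shows "openin \<T> {y \<in> V. q i (y - x) < r}"
proof (cases "0 < r")
  case True
  then show ?thesis
    unfolding seminorm_topology_def using assms by (intro topology_generated_by_Basis) blast
next
  case False
  then have "{y \<in> V. q i (y - x) < r} = {}"
    using assms q_nonneg closed_ops(4) by fastforce
  then show ?thesis by (simp only: openin_empty)
qed

text \<open>The balls, with arbitrary centres, form only a subbase; the induction recentres them at
  \<open>x\<close>. Without directedness, finitely many seminorms may be required at once.\<close>

lemma openin_imp_finite_ball:
  assumes "openin \<T> W" "x \<in> W"
  obtains F r where "finite F" "F \<subseteq> I" "0 < r" "{y \<in> V. \<forall>i\<in>F. q i (y - x) < r} \<subseteq> W"
proof -
  have "generate_topology_on {{y \<in> V. q i (y - x) < r} |x i r. x \<in> V \<and> i \<in> I \<and> 0 < r} W"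
    using assms by (simp add: seminorm_topology_def openin_topology_generated_by_iff)
  then have "\<exists>F r. finite F \<and> F \<subseteq> I \<and> 0 < r \<and> {y \<in> V. \<forall>i\<in>F. q i (y - x) < r} \<subseteq> W"
    using \<open>x \<in> W\<close>
  proof (induction arbitrary: x)
    case Empty
    then show ?case by simp
  next
    case (Int A B)
    obtain F r where F: "finite F" "F \<subseteq> I" "0 < r" "{y \<in> V. \<forall>i\<in>F. q i (y - x) < r} \<subseteq> A"
      using Int.IH(1)[of x] Int.prems by auto
    obtain G t where G: "finite G" "G \<subseteq> I" "0 < t" "{y \<in> V. \<forall>i\<in>G. q i (y - x) < t} \<subseteq> B"
      using Int.IH(2)[of x] Int.prems by auto
    show ?case
      using F G by (intro exI[of _ "F \<union> G"] exI[of _ "min r t"]) auto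
  next
    case (UN K)
    then show ?case by (meson Union_iff Union_upper order_trans)
  next
    case (Basis B)
    then obtain z i t where z: "z \<in> V" "i \<in> I" and B: "B = {y \<in> V. q i (y - z) < t}"
      by blast
    have x: "x \<in> V" "q i (x - z) < t" using Basis B by auto
    \<comment> \<open>The remaining distance \<open>t - q i (x - z)\<close> serves as radius around
      the new centre \<open>x\<close>.\<close>
    then have "{y \<in> V. \<forall>j\<in>{i}. q j (y - x) < t - q i (x - z)} \<subseteq> B"
      unfolding B using q_triangle[OF z(2) _ x(1) z(1)] by fastforce
    then show ?case
      using z x by (intro exI[of _ "{i}"] exI[of _ "t - q i (x - z)"]) auto
  qed
  then show ?thesis using that by blast
qed

lemma openinI:
  assumes "W \<subseteq> V" "\<And>x. x \<in> W \<Longrightarrow> \<exists>i\<in>I. \<exists>r>0. {y \<in> V. q i (y - x) < r} \<subseteq> W"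
  shows "openin \<T> W"
proof (subst openin_subopen, intro ballI)
  fix x assume "x \<in> W"
  then obtain i r where "i \<in> I" "0 < r" "{y \<in> V. q i (y - x) < r} \<subseteq> W"
    using assms by blast
  moreover have "x \<in> {y \<in> V. q i (y - x) < r}"
    using \<open>x \<in> W\<close> assms(1) \<open>i \<in> I\<close> \<open>0 < r\<close> by (auto simp: q_zero)
  ultimately show "\<exists>T. openin \<T> T \<and> x \<in> T \<and> T \<subseteq> W"
    using openin_ball \<open>x \<in> W\<close> assms(1) by blast
qed

text \<open>Scaling \<open>x\<close> into a seminorm ball inside \<open>W\<close> turns the bound 1
  into a homogeneous estimate. \<open>N\<close> will be a seminorm composed with a linear
  map.\<close>

lemma q_le_sum:
  fixes N :: "'v \<Rightarrow> real"
  assumes W: "openin \<T> W" "0 \<in> W" "\<And>x. x \<in> W \<Longrightarrow> N x \<le> 1"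
    and N: "\<And>r x. x \<in> V \<Longrightarrow> 0 < r \<Longrightarrow> N (s (of_real r) x) = r * N x"
  obtains F C where "finite F" "F \<subseteq> I" "0 < C" "\<And>x. x \<in> V \<Longrightarrow> N x \<le> C * (\<Sum>i\<in>F. q i x)"
proof -
  obtain F r where F: "finite F" "F \<subseteq> I" "0 < r" "{y \<in> V. \<forall>i\<in>F. q i (y - 0) < r} \<subseteq> W"
    by (rule openin_imp_finite_ball[OF W(1,2)])
  have "N x \<le> (1 / r) * (\<Sum>i\<in>F. q i x)" if x: "x \<in> V" for x
  proof (rule field_le_epsilon)
    fix e :: real assume "0 < e"
    \<comment> \<open>The summand \<open>r * e\<close> keeps \<open>t\<close> positive when all
      seminorms in \<open>F\<close> vanish at \<open>x\<close>; it costs only the error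
      \<open>e\<close>.\<close>
    define t where "t = (\<Sum>i\<in>F. q i x) + r * e"
    have sum: "0 \<le> (\<Sum>i\<in>F. q i x)"
      using F x q_nonneg by (intro sum_nonneg) blast
    have t: "0 < t" unfolding t_def using sum F \<open>0 < e\<close> by (simp add: add_nonneg_pos)
    have "q i (s (of_real (r / t)) x) < r" if "i \<in> F" for i
    proof -
      have "q i x \<le> (\<Sum>i\<in>F. q i x)"
        using that F x q_nonneg by (intro member_le_sum) auto
      then have "q i x < t" unfolding t_def using F \<open>0 < e\<close> by (smt (verit) mult_pos_pos)
      then have "r * q i x < r * t" using F by simp
      then have "r / t * q i x < r" using t by (simp add: field_simps)
      moreover have "norm (of_real (r / t) :: 'k) = r / t"
        using F t unfolding norm_of_real by simp
      ultimately show ?thesis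
        using that F x by (subst q_scale) auto
    qed
    then have "s (of_real (r / t)) x \<in> {y \<in> V. \<forall>i\<in>F. q i (y - 0) < r}"
      using x closed_ops(3) by simp
    then have "N (s (of_real (r / t)) x) \<le> 1"
      using W(3) F(4) by blast
    moreover have "N (s (of_real (r / t)) x) = (r / t) * N x"
      using N x F t by (intro N) simp_all
    ultimately have "(r / t) * N x \<le> 1" by simp
    then have "N x \<le> t / r" using F t by (simp add: field_simps)
    also have "\<dots> = 1 / r * (\<Sum>i\<in>F. q i x) + e"
      unfolding t_def using F by (simp add: field_simps)
    finally show "N x \<le> 1 / r * (\<Sum>i\<in>F. q i x) + e" .
  qed
  then show ?thesis using that[of F "1 / r"] F by simp
qed

end

text \<open>Directedness replaces two terms at a time by a multiple of one seminorm. This is how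
  \<open>dual_seminormD\<close> bounds a continuous functional by a single seminorm.\<close>

lemma directed_sum_bound:
  assumes "seminorm_family s V UNIV q" "directed_seminorms V q" "finite F"
  obtains i C where "0 < C" "\<And>x. x \<in> V \<Longrightarrow> (\<Sum>i\<in>F. q i x) \<le> C * q i x"
proof -
  interpret seminorm_family s V UNIV q by fact
  have "\<exists>i C. 0 < C \<and> (\<forall>x\<in>V. (\<Sum>i\<in>F. q i x) \<le> C * q i x)"
    using \<open>finite F\<close>
  proof (induction F)
    case empty
    then show ?case using q_nonneg by (intro exI[of _ undefined] exI[of _ 1]) auto
  next
    case (insert k F)
    obtain i C where C: "0 < C" "\<forall>x\<in>V. (\<Sum>i\<in>F. q i x) \<le> C * q i x"
      using insert by blast
    obtain l D where D: "0 < D" "\<forall>x\<in>V. max (q k x) (q i x) \<le> D * q l x"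
      using \<open>directed_seminorms V q\<close> unfolding directed_seminorms_def by blast
    have "(\<Sum>i\<in>insert k F. q i x) \<le> (D + C * D) * q l x" if "x \<in> V" for x
    proof -
      have "(\<Sum>i\<in>insert k F. q i x) \<le> q k x + C * q i x"
        using C that insert by simp
      also have "\<dots> \<le> D * q l x + C * (D * q l x)"
        using D that C by (intro add_mono mult_left_mono) auto
      finally show ?thesis by (simp add: algebra_simps)
    qed
    moreover have "0 < D + C * D" using C D by (simp add: add_pos_pos)
    ultimately show ?case by blast
  qed
  then show ?thesis using that by blast
qed

text \<open>Only an upper estimate for scaling is asked for: applied to the inverse scalar, it gives
  the opposite one.\<close>

lemma seminorm_familyI:
  assumes "vector_space s" and sub: "module.subspace s V" and "I \<noteq> {}"
    and nonneg: "\<And>i x. i \<in> I \<Longrightarrow> x \<in> V \<Longrightarrow> 0 \<le> q i x"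
    and add: "\<And>i x y. i \<in> I \<Longrightarrow> x \<in> V \<Longrightarrow> y \<in> V \<Longrightarrow> q i (x + y) \<le> q i x + q i y"
    and scale: "\<And>i x c. i \<in> I \<Longrightarrow> x \<in> V \<Longrightarrow> q i (s c x) \<le> norm c * q i x"
  shows "seminorm_family s V I q"
proof -
  interpret vector_space s by fact
  have "q i (s c x) = norm c * q i x" if i: "i \<in> I" and x: "x \<in> V" for i x c
  proof (cases "c = 0")
    case True
    then show ?thesis
      using scale[OF i x, of c] nonneg[OF i subspace_scale[OF sub x], of c] by simp
  next
    case False
    have "q i (s (inverse c) (s c x)) \<le> norm (inverse c) * q i (s c x)"
      using i subspace_scale[OF sub x] by (rule scale)
    moreover have "s (inverse c) (s c x) = x"
      using False by simp
    ultimately have "norm c * q i x \<le> q i (s c x)"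
      using False unfolding norm_inverse by (simp add: field_simps)
    then show ?thesis using scale[OF i x, of c] by simp
  qed
  then show ?thesis
    using assms by (intro seminorm_family.intro seminorm_family_axioms.intro) auto
qed

lemma (in seminorm_family) closedin_seminorm_le:
  "closedin \<T> {x \<in> V. \<forall>i\<in>I. q i x \<le> c i}"
proof -
  have "openin \<T> (V - {x \<in> V. \<forall>i\<in>I. q i x \<le> c i})"
  proof (rule openinI)
    fix x assume "x \<in> V - {x \<in> V. \<forall>i\<in>I. q i x \<le> c i}"
    then obtain i where i: "i \<in> I" and x: "x \<in> V" "c i < q i x" by force
    have "c i < q i y" if "y \<in> V" "q i (y - x) < q i x - c i" for y
      using q_add[OF i closed_ops(4)[OF x(1) that(1)] that(1)] q_minus_commute[OF i that(1) x(1)] that(2)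
      by simp
    then have "{y \<in> V. q i (y - x) < q i x - c i} \<subseteq> V - {x \<in> V. \<forall>i\<in>I. q i x \<le> c i}"
      using i by fastforce
    then show "\<exists>i\<in>I. \<exists>r>0. {y \<in> V. q i (y - x) < r} \<subseteq> V - {x \<in> V. \<forall>i\<in>I. q i x \<le> c i}"
      using i x(2) by (intro bexI[of _ i] exI[of _ "q i x - c i"]) auto
  qed blast
  then show ?thesis
    by (auto simp: closedin_def topspace_seminorm_topology)
qed

section \<open>Continuity of maps in terms of seminorms\<close>

lemma continuous_map_seminormI:
  assumes "seminorm_family s V I q" "seminorm_family t V' I' q'"
    and maps: "\<And>x. x \<in> V \<Longrightarrow> f x \<in> V'"
    and diff: "\<And>x y. x \<in> V \<Longrightarrow> y \<in> V \<Longrightarrow> f x - f y = f (x - y)"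
    and bound: "\<And>j. j \<in> I' \<Longrightarrow> \<exists>i\<in>I. \<exists>C>0. \<forall>x\<in>V. q' j (f x) \<le> C * q i x"
  shows "continuous_map (seminorm_topology V I q) (seminorm_topology V' I' q') f"
proof -
  interpret A: seminorm_family s V I q by fact
  interpret B: seminorm_family t V' I' q' by fact
  have "openin A.\<T> (f -` W \<inter> topspace A.\<T>)"
    if W: "W \<in> {{y \<in> V'. q' j (y - z) < r} |z j r. z \<in> V' \<and> j \<in> I' \<and> 0 < r}" for W
  proof -
    obtain z j r where z: "z \<in> V'" "j \<in> I'" and W: "W = {y \<in> V'. q' j (y - z) < r}"
      using W by blast
    obtain i C where C: "i \<in> I" "0 < C" "\<And>x. x \<in> V \<Longrightarrow> q' j (f x) \<le> C * q i x"
      using bound[OF z(2)] by blast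
    have "openin A.\<T> {x \<in> topspace A.\<T>. f x \<in> W}"
    proof (rule A.openinI)
      fix x assume "x \<in> {x \<in> topspace A.\<T>. f x \<in> W}"
      then have x: "x \<in> V" "q' j (f x - z) < r"
        by (auto simp: A.topspace_seminorm_topology W)
      have "f y \<in> W" if "y \<in> V" "q i (y - x) < (r - q' j (f x - z)) / C" for y
      proof -
        have "q' j (f y - z) \<le> q' j (f y - f x) + q' j (f x - z)"
          using B.q_triangle z maps x that by blast
        also have "q' j (f y - f x) \<le> C * q i (y - x)"
          using C(3) diff x that A.closed_ops(4) by simp
        also have "C * q i (y - x) < r - q' j (f x - z)"
          using that C by (simp add: pos_less_divide_eq mult.commute)
        finally show ?thesis using that maps by (simp add: W)
      qed
      moreover have "0 < (r - q' j (f x - z)) / C" using x C by simp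
      ultimately show "\<exists>i\<in>I. \<exists>r>0. {y \<in> V. q i (y - x) < r} \<subseteq> {x \<in> topspace A.\<T>. f x \<in> W}"
        using C(1) unfolding A.topspace_seminorm_topology by blast
    qed (simp add: A.topspace_seminorm_topology)
    moreover have "f -` W \<inter> topspace A.\<T> = {x \<in> topspace A.\<T>. f x \<in> W}" by blast
    ultimately show ?thesis by simp
  qed
  moreover have "f ` topspace A.\<T> \<subseteq> \<Union> {{y \<in> V'. q' j (y - z) < r} |z j r. z \<in> V' \<and> j \<in> I' \<and> 0 < r}"
    using maps B.topspace_seminorm_topology
    unfolding A.topspace_seminorm_topology seminorm_topology_def topology_generated_by_topspace
    by blast
  ultimately show ?thesis
    unfolding seminorm_topology_def[of V' I' q'] by (rule continuous_on_generated_topo)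
qed

text \<open>\<open>q_le_sum\<close> is applied to \<open>q' j\<close> composed with
  \<open>f\<close>, on the preimage of the unit ball of \<open>q' j\<close>.\<close>

lemma continuous_map_seminormD:
  assumes "seminorm_family s V I q" "seminorm_family t V' I' q'"
    and cont: "continuous_map (seminorm_topology V I q) (seminorm_topology V' I' q') f"
    and scale: "\<And>c x. x \<in> V \<Longrightarrow> f (s c x) = t c (f x)" and "j \<in> I'"
  shows "\<exists>F C. finite F \<and> F \<subseteq> I \<and> 0 < C \<and> (\<forall>x\<in>V. q' j (f x) \<le> C * (\<Sum>i\<in>F. q i x))"
proof -
  interpret A: seminorm_family s V I q by fact
  interpret B: seminorm_family t V' I' q' by fact
  have maps: "f x \<in> V'" if "x \<in> V" for x
    using cont that by (auto simp: continuous_map_def A.topspace_seminorm_topology B.topspace_seminorm_topology)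
  have f0: "f 0 = 0"
    using scale[of 0 0] A.closed_ops(1) by simp
  show ?thesis
  proof (rule A.q_le_sum[of "{x \<in> V. f x \<in> {y \<in> V'. q' j (y - 0) < 1}}" "\<lambda>x. q' j (f x)"])
    show "openin A.\<T> {x \<in> V. f x \<in> {y \<in> V'. q' j (y - 0) < 1}}"
      using openin_continuous_map_preimage[OF cont B.openin_ball[OF B.closed_ops(1) \<open>j \<in> I'\<close>]]
      by (simp add: A.topspace_seminorm_topology)
    show "q' j (f (s (of_real r) x)) = r * q' j (f x)" if "x \<in> V" "0 < r" for r x
      using that maps by (simp add: scale B.q_scale \<open>j \<in> I'\<close>)
    show ?thesis if "finite F" "F \<subseteq> I" "0 < C" "\<And>x. x \<in> V \<Longrightarrow> q' j (f x) \<le> C * (\<Sum>i\<in>F. q i x)" for F C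
      using that by blast
  qed (use A.closed_ops B.closed_ops B.q_zero \<open>j \<in> I'\<close> f0 in auto)
qed

lemma vector_space_mult: "vector_space ((*) :: 'k::field \<Rightarrow> 'k \<Rightarrow> 'k)"
  by standard (simp_all add: algebra_simps)

lemma seminorm_family_norm:
  "seminorm_family ((*) :: 'k \<Rightarrow> 'k \<Rightarrow> 'k::real_normed_field) UNIV UNIV scalar_norm"
proof -
  interpret vector_space "(*) :: 'k \<Rightarrow> 'k \<Rightarrow> 'k"
    by (rule vector_space_mult)
  show ?thesis
    by standard (simp_all add: norm_triangle_ineq norm_mult)
qed

text \<open>This lets scalar-valued functionals be treated as maps between seminorm topologies, so
  that both continuity criteria apply to them.\<close>

lemma seminorm_topology_norm:
  "seminorm_topology UNIV UNIV (scalar_norm :: _ \<Rightarrow> 'k::real_normed_field \<Rightarrow> real) = euclidean"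
proof -
  interpret seminorm_family "(*) :: 'k \<Rightarrow> 'k \<Rightarrow> 'k" UNIV UNIV scalar_norm
    by (rule seminorm_family_norm)
  have "openin \<T> W \<longleftrightarrow> open W" for W
  proof
    assume W: "openin \<T> W"
    have "\<exists>e>0. ball x e \<subseteq> W" if "x \<in> W" for x
    proof -
      obtain F :: "unit set" and r where F: "finite F" "F \<subseteq> UNIV" "0 < r" "{y \<in> UNIV. \<forall>i\<in>F. norm (y - x) < r} \<subseteq> W"
        by (rule openin_imp_finite_ball[OF W \<open>x \<in> W\<close>])
      then show ?thesis
        by (intro exI[of _ r]) (auto simp: dist_norm norm_minus_commute)
    qed
    then show "open W" by (simp add: open_contains_ball)
  next
    assume W: "open W"
    show "openin \<T> W"
    proof (rule openinI)
      fix x assume "x \<in> W"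
      then obtain e where "e > 0" "ball x e \<subseteq> W" using W open_contains_ball by blast
      then show "\<exists>i\<in>UNIV. \<exists>r>0. {y \<in> UNIV. norm (y - x) < r} \<subseteq> W"
        by (auto simp: dist_norm norm_minus_commute subset_iff)
    qed simp
  qed
  then show ?thesis by (simp add: topology_eq)
qed

lemma vector_space_fun_scale:
  assumes "vector_space s"
  shows "vector_space (fun_scale s :: 'k::field \<Rightarrow> ('x \<Rightarrow> 'v::ab_group_add) \<Rightarrow> 'x \<Rightarrow> 'v)"
proof -
  interpret vector_space s by fact
  show ?thesis
    by standard (simp_all add: fun_scale_def fun_eq_iff scale_right_distrib scale_left_distrib)
qed


subsection \<open>The Hahn--Banach theorem\<close>

text \<open>
  Minimal sublinear functionals are linear, so no partially defined functionals are needed.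
\<close>

locale scaled_space = vector_space s
  for s :: "'k::real_or_complex \<Rightarrow> 'e::ab_group_add \<Rightarrow> 'e"
begin

definition sublinear :: "('e \<Rightarrow> real) \<Rightarrow> bool" where
  "sublinear l \<longleftrightarrow> (\<forall>x y. l (x + y) \<le> l x + l y) \<and> (\<forall>r>0. \<forall>x. l (s (of_real r) x) = r * l x)"

lemma sublinearD:
  assumes "sublinear l"
  shows "l (x + y) \<le> l x + l y" "0 < r \<Longrightarrow> l (s (of_real r) x) = r * l x" "l 0 = 0" "- l (- x) \<le> l x"
proof -
  show add: "l (x + y) \<le> l x + l y" for x y
    using assms by (simp add: sublinear_def)
  show scale: "0 < r \<Longrightarrow> l (s (of_real r) x) = r * l x" for r x
    using assms by (simp add: sublinear_def)
  show zero: "l 0 = 0"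
    using scale[of 2 0] by simp
  show "- l (- x) \<le> l x"
    using add[of x "- x"] zero by simp
qed

text \<open>For minimal \<open>l\<close>, \<open>shift y l = l\<close> gives \<open>l x + l y \<le> l (x + y)\<close>.\<close>

definition shift :: "'e \<Rightarrow> ('e \<Rightarrow> real) \<Rightarrow> 'e \<Rightarrow> real" where
  "shift y l x = (INF t\<in>{0..}. l (x + s (of_real t) y) - t * l y)"

text \<open>The bound does not depend on \<open>t\<close>, so the infimum that defines
  \<open>shift\<close> is finite.\<close>

lemma shift_lower:
  assumes l: "sublinear l" and "0 \<le> t"
  shows "- l (- x) \<le> l (x + s (of_real t) y) - t * l y"
proof (cases "t = 0")
  case True
  then show ?thesis using sublinearD(4)[OF l] by simp
next
  case False
  then have "t * l y = l (s (of_real t) y)"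
    using sublinearD(2)[OF l] \<open>0 \<le> t\<close> by simp
  also have "\<dots> \<le> l (x + s (of_real t) y) + l (- x)"
    using sublinearD(1)[OF l, of "x + s (of_real t) y" "- x"] by simp
  finally show ?thesis by simp
qed

lemma shift_le:
  assumes l: "sublinear l" and "0 \<le> t"
  shows "shift y l x \<le> l (x + s (of_real t) y) - t * l y"
  unfolding shift_def
proof (rule cINF_lower)
  show "bdd_below ((\<lambda>t. l (x + s (of_real t) y) - t * l y) ` {0..})"
    using shift_lower[OF l] by (intro bdd_belowI[of _ "- l (- x)"]) auto
qed (use assms in simp)

lemma shift_greatest:
  assumes "\<And>t. 0 \<le> t \<Longrightarrow> c \<le> l (x + s (of_real t) y) - t * l y"
  shows "c \<le> shift y l x"
  unfolding shift_def using assms by (intro cINF_greatest) auto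

text \<open>Parameters \<open>t\<close> and \<open>u\<close> for the two arguments combine to the
  admissible parameter \<open>t + u\<close> for the sum. For homogeneity the parameter is rescaled
  to \<open>r * t\<close>; the reverse inequality is the same one for
  \<open>inverse r\<close>.\<close>

lemma sublinear_shift:
  assumes l: "sublinear l"
  shows "sublinear (shift y l)"
proof -
  have "shift y l (x + z) \<le> shift y l x + shift y l z" for x z
  proof -
    have "shift y l (x + z) - (l (x + s (of_real t) y) - t * l y) \<le> shift y l z" if "0 \<le> t" for t
    proof (rule shift_greatest)
      fix u :: real assume "0 \<le> u"
      have "shift y l (x + z) \<le> l (x + z + s (of_real (t + u)) y) - (t + u) * l y"
        using l that \<open>0 \<le> u\<close> by (intro shift_le) auto
      also have "x + z + s (of_real (t + u)) y = (x + s (of_real t) y) + (z + s (of_real u) y)"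
        by (simp add: scale_left_distrib algebra_simps)
      also have "l \<dots> \<le> l (x + s (of_real t) y) + l (z + s (of_real u) y)"
        using sublinearD(1)[OF l] .
      finally show "shift y l (x + z) - (l (x + s (of_real t) y) - t * l y) \<le> l (z + s (of_real u) y) - u * l y"
        by (simp add: algebra_simps)
    qed
    then have "shift y l (x + z) - shift y l z \<le> shift y l x"
      by (intro shift_greatest) (simp add: algebra_simps)
    then show ?thesis by simp
  qed
  moreover have le: "shift y l (s (of_real r) x) \<le> r * shift y l x" if "0 < r" for r x
  proof -
    have "shift y l (s (of_real r) x) / r \<le> shift y l x"
    proof (rule shift_greatest)
      fix t :: real assume "0 \<le> t"
      have "shift y l (s (of_real r) x) \<le> l (s (of_real r) x + s (of_real (r * t)) y) - (r * t) * l y"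
        using l that \<open>0 \<le> t\<close> by (intro shift_le) auto
      also have "s (of_real r) x + s (of_real (r * t)) y = s (of_real r) (x + s (of_real t) y)"
        by (simp add: scale_right_distrib)
      also have "l \<dots> = r * l (x + s (of_real t) y)"
        using sublinearD(2)[OF l that] .
      finally show "shift y l (s (of_real r) x) / r \<le> l (x + s (of_real t) y) - t * l y"
        using that by (simp add: field_simps)
    qed
    then show ?thesis using that by (simp add: field_simps)
  qed
  moreover have "r * shift y l x \<le> shift y l (s (of_real r) x)" if "0 < r" for r x
  proof -
    have "s (of_real (inverse r)) (s (of_real r) x) = x"
      using that by simp
    then have "shift y l x \<le> inverse r * shift y l (s (of_real r) x)"
      using le[of "inverse r" "s (of_real r) x"] that by simp
    then show ?thesis using that by (simp add: field_simps)
  qed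
  ultimately show ?thesis
    unfolding sublinear_def by (meson order_antisym)
qed

lemma minimal_sublinear_below:
  assumes q: "sublinear q"
  obtains m where "sublinear m" "m \<le> q" "\<And>l. sublinear l \<Longrightarrow> l \<le> m \<Longrightarrow> l = m"
proof -
  define A where "A = {l. sublinear l \<and> l \<le> q}"
  have "\<exists>m\<in>A. \<forall>a\<in>A. a \<le> m \<longrightarrow> a = m"
  proof (rule predicate_Zorn)
    \<comment> \<open>The order is reversed, so that the upper bound of a chain required by Zorn's
      lemma is a pointwise lower bound.\<close>
    show "partial_order_on A (relation_of (\<lambda>a b. b \<le> a) A)"
      by (rule partial_order_on_relation_ofI) auto
  next
    fix C assume "C \<in> Chains (relation_of (\<lambda>a b. b \<le> a) A)"
    then have C: "C \<subseteq> A" and chain: "\<And>a b. a \<in> C \<Longrightarrow> b \<in> C \<Longrightarrow> a \<le> b \<or> b \<le> a"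
      unfolding Chains_def relation_of_def by blast+
    show "\<exists>u\<in>A. \<forall>a\<in>C. u \<le> a"
    proof (cases "C = {}")
      case True
      then show ?thesis using q by (auto simp: A_def)
    next
      case False
      define u where "u x = (INF l\<in>C. l x)" for x
      \<comment> \<open>This bound is common to all sublinear functionals below \<open>q\<close> and
        keeps the infimum \<open>u\<close> finite.\<close>
      have lower: "- q (- x) \<le> l x" if "l \<in> C" for l x
      proof -
        have "l (- x) \<le> q (- x)" "- l (- x) \<le> l x"
          using that C sublinearD(4) by (auto simp: A_def le_fun_def)
        then show ?thesis by linarith
      qed
      have le: "u x \<le> l x" if "l \<in> C" for l x
        unfolding u_def using that lower by (intro cINF_lower bdd_belowI[of _ "- q (- x)"]) auto
      have greatest: "c \<le> u x" if "\<And>l. l \<in> C \<Longrightarrow> c \<le> l x" for c x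
        unfolding u_def using that False by (intro cINF_greatest) auto
      have "u (x + y) \<le> u x + u y" for x y
      proof -
        \<comment> \<open>The two infima may be approached by different members of the chain; the
          smaller of \<open>l\<close> and \<open>k\<close> lies below both.\<close>
        have *: "u (x + y) \<le> l x + k y" if lk: "l \<in> C" "k \<in> C" for l k
        proof -
          obtain i where i: "i \<in> C" "i \<le> l" "i \<le> k" using chain[OF lk] lk by blast
          have "u (x + y) \<le> i (x + y)" using le i by blast
          also have "\<dots> \<le> i x + i y" using i C sublinearD(1) by (auto simp: A_def)
          also have "\<dots> \<le> l x + k y" using i by (intro add_mono) (auto simp: le_fun_def)
          finally show ?thesis .
        qed
        have "u (x + y) - l x \<le> u y" if "l \<in> C" for l
          using *[OF that] by (intro greatest) (simp add: algebra_simps)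
        then have "u (x + y) - u y \<le> u x"
          by (intro greatest) (simp add: algebra_simps)
        then show ?thesis by simp
      qed
      moreover have "u (s (of_real r) x) = r * u x" if "0 < r" for r x
      proof -
        have scale: "l (s (of_real r) x) = r * l x" if "l \<in> C" for l
          using that C sublinearD(2) \<open>0 < r\<close> by (auto simp: A_def)
        have "u (s (of_real r) x) / r \<le> u x"
          using le[of _ "s (of_real r) x"] that
          by (intro greatest) (simp add: scale pos_divide_le_eq mult.commute)
        moreover have "r * u x \<le> u (s (of_real r) x)"
          using le[of _ x] that by (intro greatest) (simp add: scale)
        ultimately show ?thesis using that by (simp add: pos_divide_le_eq mult.commute)
      qed
      ultimately have "sublinear u" by (simp add: sublinear_def)
      moreover have "u \<le> q"
      proof (rule le_funI)
        fix x
        obtain l where "l \<in> C" using False by blast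
        then show "u x \<le> q x"
          using le[of l x] C by (auto simp: A_def le_fun_def intro: order_trans)
      qed
      ultimately have "u \<in> A" by (simp add: A_def)
      then show ?thesis using le by (auto simp: le_fun_def)
    qed
  qed
  then obtain m where m: "m \<in> A" "\<And>a. a \<in> A \<Longrightarrow> a \<le> m \<Longrightarrow> a = m" by blast
  show ?thesis
  proof (rule that)
    show "l = m" if "sublinear l" "l \<le> m" for l
      using that m order_trans by (auto simp: A_def)
  qed (use m in \<open>auto simp: A_def\<close>)
qed

lemma real_hahn_banach:
  assumes q: "sublinear q"
  obtains l where "\<And>x y. l (x + y) = l x + l y" "\<And>r x. l (s (of_real r) x) = r * l x" "\<And>x. l x \<le> q x"
proof -
  obtain m where m: "sublinear m" "m \<le> q" and min: "\<And>l. sublinear l \<Longrightarrow> l \<le> m \<Longrightarrow> l = m"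
    using minimal_sublinear_below[OF q] by blast
  \<comment> \<open>Taking \<open>t = 0\<close> gives \<open>shift y m \<le> m\<close>, so
    minimality applies.\<close>
  have "shift y m = m" for y
    using sublinear_shift[OF m(1)] shift_le[OF m(1), of 0 y]
    by (intro min) (auto simp: le_fun_def)
  then have add: "m (x + y) = m x + m y" for x y
    using shift_le[OF m(1), of 1 y x] sublinearD(1)[OF m(1), of x y] by simp
  have minus: "m (- x) = - m x" for x
    using add[of x "- x"] sublinearD(3)[OF m(1)] by simp
  have "m (s (of_real r) x) = r * m x" for r x
  proof (cases r "0 :: real" rule: linorder_cases)
    case less
    then show ?thesis
      using sublinearD(2)[OF m(1), of "- r" x] minus[of "s (of_real r) x"] by simp
  next
    case equal
    then show ?thesis using sublinearD(3)[OF m(1)] by simp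
  next
    case greater
    then show ?thesis using sublinearD(2)[OF m(1)] by simp
  qed
  with add m(2) show ?thesis using that[of m] by (auto simp: le_fun_def)
qed

text \<open>Dominating by \<open>shift x0 q\<close> rather than \<open>q\<close> forces
  \<open>l (- x0) \<le> - q x0\<close>, which makes the functional attain \<open>q\<close> at
  \<open>x0\<close>. The real functional is then turned into a scalar one below the same
  seminorm.\<close>

lemma hahn_banach_seminorm:
  assumes q: "seminorm s q"
  obtains e where "\<And>x y. e (x + y) = e x + e y" "\<And>c x. e (s c x) = c * e x"
    "\<And>x. norm (e x) \<le> q x" "norm (e x0) = q x0"
proof -
  have "sublinear q"
    using q by (simp add: sublinear_def seminorm_def)
  obtain l where add: "\<And>x y. l (x + y) = l x + l y" and scale: "\<And>r x. l (s (of_real r) x) = r * l x"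
    and le: "\<And>x. l x \<le> shift x0 q x"
    using real_hahn_banach[OF sublinear_shift[OF \<open>sublinear q\<close>]] by blast
  have lq: "l x \<le> q x" for x
    using le[of x] shift_le[OF \<open>sublinear q\<close>, of 0 x0 x] by simp
  have "l (- x0) \<le> - q x0"
    using le[of "- x0"] shift_le[OF \<open>sublinear q\<close>, of 1 x0 "- x0"] sublinearD(3)[OF \<open>sublinear q\<close>] by simp
  moreover have "l (- x0) = - l x0"
    using scale[of "-1" x0] by simp
  ultimately have lx0: "q x0 \<le> l x0" by simp
  have "\<exists>k. \<forall>c. l (s c x) = re_part (c * k)" for x
  proof -
    have "l (s (c + d) x) = l (s c x) + l (s d x)" for c d
      by (simp add: scale_left_distrib add)
    moreover have "l (s (of_real a * c) x) = a * l (s c x)" for a c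
      using scale[of a "s c x"] by simp
    ultimately obtain k where "\<And>c. l (s c x) = re_part (c * k)"
      using re_part_representation[of "\<lambda>c. l (s c x)"] by blast
    then show ?thesis by blast
  qed
  \<comment> \<open>In the complex case this is the usual e(x) = l(x) - i l(i x).\<close>
  then obtain e where e: "\<And>x c. l (s c x) = re_part (c * e x)" by metis
  have norm_le: "norm (e x) \<le> q x" for x
  proof -
    obtain c where c: "norm c = 1" "re_part (c * e x) = norm (e x)"
      using unit_multiple_re_part by blast
    then have "norm (e x) = l (s c x)" using e by simp
    also have "\<dots> \<le> q (s c x)" by (rule lq)
    also have "\<dots> = q x" using q c by (simp add: seminorm_def)
    finally show ?thesis .
  qed
  show ?thesis
  proof (rule that)
    show "e (x + y) = e x + e y" for x y
      by (rule re_part_eqI) (simp add: e[symmetric] distrib_left re_part_add scale_right_distrib add)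
    show "e (s c x) = c * e x" for c x
      by (rule re_part_eqI) (simp add: e[symmetric] flip: mult.assoc)
    show "norm (e x0) = q x0"
      using norm_le[of x0] lx0 e[of 1 x0] re_part_le_norm[of "e x0"] by simp
  qed (rule norm_le)
qed

end


subsection \<open>Functionals on compact sets\<close>

lemma dualD:
  assumes "e \<in> dual s X"
  shows "x \<in> topspace X \<Longrightarrow> y \<in> topspace X \<Longrightarrow> e (x + y) = e x + e y"
    "x \<in> topspace X \<Longrightarrow> e (s c x) = c * e x" "continuous_map X euclidean e"
    "x \<notin> topspace X \<Longrightarrow> e x = 0"
  using assms by (auto simp: dual_def cont_lin_def)

lemma subspace_dual:
  fixes s :: "'a::real_normed_field \<Rightarrow> 'b::ab_group_add \<Rightarrow> 'b"
  shows "module.subspace (fun_scale (*)) (dual s X)"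
proof -
  interpret vector_space "fun_scale (*) :: 'a \<Rightarrow> ('b \<Rightarrow> 'a) \<Rightarrow> 'b \<Rightarrow> 'a"
    by (intro vector_space_fun_scale vector_space_mult)
  show ?thesis
  proof (rule subspaceI)
    show "0 \<in> dual s X"
      by (simp add: dual_def cont_lin_def zero_fun_def)
  next
    fix u v assume "u \<in> dual s X" "v \<in> dual s X"
    moreover from this have "continuous_map X euclidean (\<lambda>x. u x + v x)"
      by (intro continuous_map_add dualD)
    ultimately show "u + v \<in> dual s X"
      by (simp add: dual_def cont_lin_def plus_fun_def algebra_simps)
  next
    fix c u assume u: "u \<in> dual s X"
    have "continuous_map X euclidean ((*) c \<circ> u)"
      using dualD(3)[OF u] by (rule continuous_map_compose) (simp add: continuous_intros)
    with u show "fun_scale (*) c u \<in> dual s X"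
      by (simp add: dual_def cont_lin_def fun_scale_def o_def algebra_simps)
  qed
qed

lemma dual_linear_combination:
  fixes s :: "'a::real_normed_field \<Rightarrow> 'b::ab_group_add \<Rightarrow> 'b"
  assumes add: "\<And>e e'. e \<in> dual s X \<Longrightarrow> e' \<in> dual s X \<Longrightarrow> \<phi> (e + e') = \<phi> e + \<phi> e'"
    and scale: "\<And>c e. e \<in> dual s X \<Longrightarrow> \<phi> (fun_scale (*) c e) = c * \<phi> e"
    and F: "finite F" "F \<subseteq> dual s X"
  shows "(\<lambda>x. \<Sum>f\<in>F. c f * f x) \<in> dual s X \<and> \<phi> (\<lambda>x. \<Sum>f\<in>F. c f * f x) = (\<Sum>f\<in>F. c f * \<phi> f)"
proof -
  interpret vector_space "fun_scale (*) :: 'a \<Rightarrow> ('b \<Rightarrow> 'a) \<Rightarrow> 'b \<Rightarrow> 'a"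
    by (intro vector_space_fun_scale vector_space_mult)
  show ?thesis
    using F
  proof (induction F)
    case empty
    have zero: "(\<lambda>_. 0) \<in> dual s X"
      using subspace_0[OF subspace_dual] by (simp add: zero_fun_def)
    then show ?case
      using scale[OF zero, of 0] by (simp add: fun_scale_def)
  next
    case (insert f F)
    let ?g = "\<lambda>x. \<Sum>f\<in>F. c f * f x"
    have *: "(\<lambda>x. \<Sum>f\<in>insert f F. c f * f x) = fun_scale (*) (c f) f + ?g"
      using insert by (simp add: fun_scale_def plus_fun_def)
    have "fun_scale (*) (c f) f \<in> dual s X"
      using insert subspace_scale[OF subspace_dual] by simp
    then show ?case
      unfolding * using insert by (simp add: subspace_add[OF subspace_dual] add scale)
  qed
qed

text \<open>The first-order condition at a minimum over a segment: for small \<open>t\<close> the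
  linear term dominates the quadratic one.\<close>

lemma nonneg_of_quadratic:
  fixes A B :: real
  assumes "\<And>t. 0 < t \<Longrightarrow> t \<le> 1 \<Longrightarrow> 0 \<le> t * A + t\<^sup>2 * B"
  shows "0 \<le> A"
proof (rule ccontr)
  assume "\<not> 0 \<le> A"
  \<comment> \<open>This \<open>t\<close> bounds \<open>t * B\<close> by half of \<open>- A\<close>;
    the added 1 keeps the denominator positive when \<open>B = 0\<close>.\<close>
  define t where "t = min 1 (- A / (2 * (\<bar>B\<bar> + 1)))"
  have t: "0 < t" "t \<le> 1" using \<open>\<not> 0 \<le> A\<close> by (auto simp: t_def intro!: divide_neg_pos)
  have "t * B \<le> t * (\<bar>B\<bar> + 1)" using t by (intro mult_left_mono) auto
  also have "\<dots> \<le> (- A / (2 * (\<bar>B\<bar> + 1))) * (\<bar>B\<bar> + 1)"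
    by (intro mult_right_mono) (auto simp: t_def)
  also have "\<dots> = - A / 2" by (simp add: field_simps)
  finally have "A + t * B < 0" using \<open>\<not> 0 \<le> A\<close> by simp
  then have "t * (A + t * B) < 0" using t by (simp add: mult_pos_neg)
  then show False using assms[OF t] by (simp add: algebra_simps power2_eq_square)
qed

lemma abs_convex_scale:
  fixes s :: "'a::real_normed_field \<Rightarrow> 'b::ab_group_add \<Rightarrow> 'b"
  assumes "vector_space s" "abs_convex s K" "x \<in> K" "norm c \<le> 1"
  shows "s c x \<in> K"
proof -
  interpret vector_space s by fact
  show ?thesis
    using assms(2-) unfolding abs_convex_def by (metis add.right_neutral norm_zero scale_zero_left)
qed

text \<open>
  At a minimum point of the sum of squared residuals over \<open>K\<close>, the first variation yields a single
  functional that contradicts the bound unless all residuals vanish.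
\<close>

lemma finite_dual_system_solvable:
  fixes s :: "'k::real_or_complex \<Rightarrow> 'e::ab_group_add \<Rightarrow> 'e"
  assumes vs: "vector_space s" and UNIV: "topspace X = UNIV"
    and K: "abs_convex s K" "compactin X K" "K \<noteq> {}"
    and add: "\<And>e e'. e \<in> dual s X \<Longrightarrow> e' \<in> dual s X \<Longrightarrow> \<phi> (e + e') = \<phi> e + \<phi> e'"
    and scale: "\<And>c e. e \<in> dual s X \<Longrightarrow> \<phi> (fun_scale (*) c e) = c * \<phi> e"
    and bound: "\<And>e b. e \<in> dual s X \<Longrightarrow> 0 \<le> b \<Longrightarrow> (\<And>z. z \<in> K \<Longrightarrow> norm (e z) \<le> b) \<Longrightarrow> norm (\<phi> e) \<le> b"
    and F: "finite F" "F \<subseteq> dual s X"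
  shows "\<exists>z\<in>K. \<forall>e\<in>F. e z = \<phi> e"
proof -
  interpret vector_space s by fact
  interpret re: additive re_part by standard (rule re_part_add)
  define Q where "Q z = (\<Sum>f\<in>F. (norm (f z - \<phi> f))\<^sup>2)" for z
  have "continuous_map X euclideanreal Q"
    unfolding Q_def using F dualD(3)
    by (intro continuous_map_sum continuous_map_real_pow continuous_map_norm continuous_map_diff) auto
  then have "compact (Q ` K)"
    using image_compactin[OF K(2), of euclideanreal Q] by simp
  then obtain z0 where z0: "z0 \<in> K" and min: "\<And>z. z \<in> K \<Longrightarrow> Q z0 \<le> Q z"
    using compact_attains_inf[of "Q ` K"] K(3) by auto
  define a where "a f = f z0 - \<phi> f" for f
  \<comment> \<open>The weights are the conjugated residuals at \<open>z0\<close>, so that twice the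
    real part of \<open>e\<close> is the derivative of \<open>Q\<close> at
    \<open>z0\<close>.\<close>
  define e where "e x = (\<Sum>f\<in>F. conj_part (a f) * f x)" for x
  have e: "e \<in> dual s X" "\<phi> e = (\<Sum>f\<in>F. conj_part (a f) * \<phi> f)"
    using dual_linear_combination[where \<phi> = \<phi>, OF add scale F, of "\<lambda>f. conj_part (a f)"]
    unfolding e_def[abs_def] by auto
  have diff: "e x - e y = (\<Sum>f\<in>F. conj_part (a f) * (f x - f y))" for x y
    by (simp add: e_def sum_subtractf algebra_simps)
  have variation: "0 \<le> re_part (e z - e z0)" if z: "z \<in> K" for z
  proof -
    have "0 \<le> 2 * re_part (e z - e z0)"
    proof (rule nonneg_of_quadratic)
      fix t :: real assume t: "0 < t" "t \<le> 1"
      define zt where "zt = s (of_real (1 - t)) z0 + s (of_real t) z"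
      have "norm (of_real (1 - t) :: 'k) + norm (of_real t :: 'k) \<le> 1"
        using t unfolding norm_of_real by simp
      then have "zt \<in> K"
        using K(1) z z0 unfolding abs_convex_def zt_def by blast
      have "(norm (f zt - \<phi> f))\<^sup>2 =
          (norm (a f))\<^sup>2 + (t * (2 * re_part (conj_part (a f) * (f z - f z0))) + t\<^sup>2 * (norm (f z - f z0))\<^sup>2)"
        if "f \<in> F" for f
      proof -
        have f: "f \<in> dual s X" using that F by blast
        have "f zt = of_real (1 - t) * f z0 + of_real t * f z"
          unfolding zt_def using dualD(1,2)[OF f] UNIV by simp
        then have *: "f zt - \<phi> f = a f + of_real t * (f z - f z0)"
          by (simp add: a_def algebra_simps)
        have mult: "conj_part (a f) * (of_real t * (f z - f z0)) = of_real t * (conj_part (a f) * (f z - f z0))"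
          by (simp add: mult.left_commute)
        then show ?thesis
          unfolding * norm_add_power2 mult re_part_of_real
          by (simp add: norm_mult power_mult_distrib)
      qed
      then have "Q zt = Q z0 + (t * (2 * re_part (e z - e z0)) + t\<^sup>2 * (\<Sum>f\<in>F. (norm (f z - f z0))\<^sup>2))"
        by (simp add: Q_def diff re.sum sum.distrib sum_distrib_left flip: a_def)
      then show "0 \<le> t * (2 * re_part (e z - e z0)) + t\<^sup>2 * (\<Sum>f\<in>F. (norm (f z - f z0))\<^sup>2)"
        using min[OF \<open>zt \<in> K\<close>] by simp
    qed
    then show ?thesis by simp
  qed
  \<comment> \<open>Absolute convexity lets \<open>z\<close> be replaced by its multiple by
    \<open>- c\<close> with unit \<open>c\<close>, which turns the one-sided variational inequality
    into a bound for the norm on all of \<open>K\<close>.\<close>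
  have norm_le: "norm (e z) \<le> - re_part (e z0)" if z: "z \<in> K" for z
  proof -
    obtain c where c: "norm c = 1" "re_part (c * e z) = norm (e z)"
      using unit_multiple_re_part by blast
    have "s (- c) z \<in> K"
      using c by (intro abs_convex_scale[OF vs K(1) z]) simp
    moreover have "e (s (- c) z) = - (c * e z)"
      using dualD(2)[OF e(1), of z "- c"] UNIV by (simp del: scale_minus_left)
    ultimately show ?thesis
      using variation[of "s (- c) z"] c by (simp add: re.diff re.minus del: scale_minus_left)
  qed
  have "norm (\<phi> e) \<le> - re_part (e z0)"
    using norm_le order_trans[OF norm_ge_zero norm_le[OF z0]] by (intro bound e(1))
  moreover have "- norm (\<phi> e) \<le> re_part (\<phi> e)"
    using re_part_le_norm[of "- \<phi> e"] by (simp add: re.minus)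
  moreover have "re_part (e z0 - \<phi> e) = Q z0"
  proof -
    have "e z0 - \<phi> e = (\<Sum>f\<in>F. conj_part (a f) * a f)"
      by (simp add: e e_def a_def sum_subtractf algebra_simps)
    also have "\<dots> = of_real (Q z0)"
      by (simp add: conj_mult_self Q_def a_def)
    finally show ?thesis
      using re_part_of_real[of "Q z0" "1 :: 'k"] by (simp add: re_part_def)
  qed
  \<comment> \<open>\<open>Q z0\<close> equals \<open>re_part (e z0) - re_part (\<phi> e)\<close>,
    where the first term is at most \<open>- norm (\<phi> e)\<close> and the second at least
    \<open>- norm (\<phi> e)\<close>.\<close>
  ultimately have "Q z0 \<le> 0" by (simp add: re.diff)
  then have "Q z0 = 0" unfolding Q_def by (meson antisym sum_nonneg zero_le_power2)
  then have "f z0 = \<phi> f" if "f \<in> F" for f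
    using F that by (simp add: Q_def sum_nonneg_eq_0_iff)
  then show ?thesis using z0 by (intro bexI[of _ z0] ballI)
qed

text \<open>Each equation cuts out a closed set, and the finite case gives the finite intersection
  property on \<open>K\<close>. This is the core of the Mackey--Arens theorem.\<close>

lemma dual_system_solvable:
  fixes s :: "'k::real_or_complex \<Rightarrow> 'e::ab_group_add \<Rightarrow> 'e"
  assumes vs: "vector_space s" and UNIV: "topspace X = UNIV"
    and K: "abs_convex s K" "compactin X K" "K \<noteq> {}"
    and add: "\<And>e e'. e \<in> dual s X \<Longrightarrow> e' \<in> dual s X \<Longrightarrow> \<phi> (e + e') = \<phi> e + \<phi> e'"
    and scale: "\<And>c e. e \<in> dual s X \<Longrightarrow> \<phi> (fun_scale (*) c e) = c * \<phi> e"
    and bound: "\<And>e b. e \<in> dual s X \<Longrightarrow> 0 \<le> b \<Longrightarrow> (\<And>z. z \<in> K \<Longrightarrow> norm (e z) \<le> b) \<Longrightarrow> norm (\<phi> e) \<le> b"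
  shows "\<exists>z\<in>K. \<forall>e\<in>dual s X. e z = \<phi> e"
proof -
  define \<U> where "\<U> = (\<lambda>e. {z \<in> topspace X. e z \<in> {\<phi> e}}) ` dual s X"
  have closed: "closedin X C" if C: "C \<in> \<U>" for C
  proof -
    obtain e where e: "e \<in> dual s X" "C = {z \<in> topspace X. e z \<in> {\<phi> e}}"
      using C unfolding \<U>_def by blast
    show ?thesis
      unfolding e(2) by (rule closedin_continuous_map_preimage[OF dualD(3)[OF e(1)]]) simp
  qed
  have fip: "K \<inter> \<Inter>\<F> \<noteq> {}" if \<F>: "finite \<F>" "\<F> \<subseteq> \<U>" for \<F>
  proof -
    obtain F where F: "finite F" "F \<subseteq> dual s X" "\<F> = (\<lambda>e. {z \<in> topspace X. e z \<in> {\<phi> e}}) ` F"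
      using \<F> unfolding \<U>_def by (meson finite_subset_image)
    have "\<exists>z\<in>K. \<forall>e\<in>F. e z = \<phi> e"
      by (rule finite_dual_system_solvable[where \<phi> = \<phi>, OF vs UNIV K add scale bound F(1,2)])
    then obtain z where "z \<in> K" "\<forall>e\<in>F. e z = \<phi> e"
      by (elim bexE)
    then have "z \<in> K \<inter> \<Inter>\<F>" by (simp add: F(3) UNIV)
    then show ?thesis by blast
  qed
  have "K \<inter> \<Inter>\<U> \<noteq> {}"
    using K(2) closed fip unfolding compactin_fip by metis
  then show ?thesis unfolding \<U>_def by auto
qed

section \<open>Continuous functionals in terms of seminorms\<close>

lemma dual_seminormI:
  assumes fam: "seminorm_family s V I q"
    and add: "\<And>x y. x \<in> V \<Longrightarrow> y \<in> V \<Longrightarrow> e (x + y) = e x + e y"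
    and scale: "\<And>c x. x \<in> V \<Longrightarrow> e (s c x) = c * e x"
    and zero: "\<And>x. x \<notin> V \<Longrightarrow> e x = 0"
    and bound: "i \<in> I" "0 < C" "\<And>x. x \<in> V \<Longrightarrow> norm (e x) \<le> C * q i x"
  shows "e \<in> dual s (seminorm_topology V I q)"
proof -
  interpret seminorm_family s V I q by fact
  have "e x - e y = e (x - y)" if "x \<in> V" "y \<in> V" for x y
    using add[of "x - y" y] closed_ops(4) that by simp
  then have "continuous_map \<T> euclidean e"
    unfolding seminorm_topology_norm[symmetric] using bound
    by (intro continuous_map_seminormI[OF fam seminorm_family_norm] bexI[of _ i] exI[of _ C]) auto
  then show ?thesis
    using add scale zero by (simp add: dual_def cont_lin_def topspace_seminorm_topology)
qed

lemma dual_seminormD: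
  assumes fam: "seminorm_family s V UNIV q" and dir: "directed_seminorms V q"
    and e: "e \<in> dual s (seminorm_topology V UNIV q)"
  obtains i C where "0 < C" "\<And>x. x \<in> V \<Longrightarrow> norm (e x) \<le> C * q i x"
proof -
  interpret seminorm_family s V UNIV q by fact
  have cont: "continuous_map \<T> (seminorm_topology UNIV UNIV scalar_norm) e"
    unfolding seminorm_topology_norm by (rule dualD(3)[OF e])
  have scale: "e (s c x) = c * e x" if "x \<in> V" for c x
    using dualD(2)[OF e] that by (simp add: topspace_seminorm_topology)
  obtain F C where F: "finite F" "F \<subseteq> UNIV" "0 < C" "\<And>x. x \<in> V \<Longrightarrow> norm (e x) \<le> C * (\<Sum>i\<in>F. q i x)"
    using continuous_map_seminormD[OF fam seminorm_family_norm cont, where j = "()"] scale by auto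
  obtain i D where D: "0 < D" "\<And>x. x \<in> V \<Longrightarrow> (\<Sum>i\<in>F. q i x) \<le> D * q i x"
    using directed_sum_bound[OF fam dir F(1)] by metis
  show ?thesis
  proof (rule that)
    show "0 < C * D" using F D by simp
    show "norm (e x) \<le> C * D * q i x" if "x \<in> V" for x
    proof -
      have "C * (\<Sum>i\<in>F. q i x) \<le> C * (D * q i x)"
        using F D that by (intro mult_left_mono) auto
      with F(4)[OF that] show ?thesis by simp
    qed
  qed
qed

text \<open>A neighbourhood of 0 that excludes \<open>x\<close> contains a finite seminorm ball, and
  that ball contains every vector on which all seminorms vanish.\<close>

lemma (in seminorm_family) Hausdorff_imp_eq_zero:
  assumes "Hausdorff_space \<T>" "x \<in> V" "\<And>i. i \<in> I \<Longrightarrow> q i x = 0"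
  shows "x = 0"
proof (rule ccontr)
  assume "x \<noteq> 0"
  then obtain W W' where W: "openin \<T> W" "0 \<in> W" "x \<in> W'" "disjnt W W'"
    using assms(1,2) closed_ops(1) unfolding Hausdorff_space_def topspace_seminorm_topology
    by metis
  obtain F r where "finite F" "F \<subseteq> I" "0 < r" "{y \<in> V. \<forall>i\<in>F. q i (y - 0) < r} \<subseteq> W"
    by (rule openin_imp_finite_ball[OF W(1,2)])
  moreover have "x \<in> {y \<in> V. \<forall>i\<in>F. q i (y - 0) < r}"
    using assms \<open>F \<subseteq> I\<close> \<open>0 < r\<close> by auto
  ultimately have "x \<in> W" by blast
  then show False using W by (auto simp: disjnt_iff)
qed

section \<open>Duality of locally convex spaces and polars of seminorms\<close>

lemma lcHs_seminorm_family:
  assumes "lcHs s p"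
  shows "seminorm_family s UNIV UNIV p"
proof -
  interpret vector_space s using assms by (simp add: lcHs_def)
  show ?thesis
    using assms by unfold_locales (auto simp: lcHs_def seminorm_def)
qed

text \<open>For a seminorm \<open>q\<close> this is the polar of its closed unit ball. It is taken
  inside the full function type, whose topology is that of pointwise convergence.\<close>

definition polar :: "('k::real_normed_field \<Rightarrow> 'e::ab_group_add \<Rightarrow> 'e) \<Rightarrow> ('e \<Rightarrow> real) \<Rightarrow> ('e \<Rightarrow> 'k) set" where
  "polar s q = {e. (\<forall>x y. e (x + y) = e x + e y) \<and> (\<forall>c x. e (s c x) = c * e x) \<and> (\<forall>x. norm (e x) \<le> q x)}"

lemma polar_subset_dual:
  assumes "lcHs s p"
  shows "polar s (p \<alpha>) \<subseteq> dual s (seminorm_topology UNIV UNIV p)"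
proof
  fix e assume "e \<in> polar s (p \<alpha>)"
  then show "e \<in> dual s (seminorm_topology UNIV UNIV p)"
    by (intro dual_seminormI[OF lcHs_seminorm_family[OF assms], where i = \<alpha> and C = 1])
      (auto simp: polar_def)
qed

lemma polar_attains:
  fixes s :: "'k::real_or_complex \<Rightarrow> 'e::ab_group_add \<Rightarrow> 'e"
  assumes "vector_space s" "seminorm s q"
  obtains e where "e \<in> polar s q" "norm (e x) = q x"
proof -
  interpret vector_space s by fact
  interpret scaled_space s by unfold_locales
  show ?thesis
    by (rule hahn_banach_seminorm[OF assms(2), of x]) (rule that, auto simp: polar_def)
qed

text \<open>By Hahn--Banach each seminorm of \<open>x - y\<close> is attained by a functional in its
  polar, so all of them vanish; the Hausdorff property finishes.\<close>

lemma dual_separates: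
  fixes s :: "'k::real_or_complex \<Rightarrow> 'e::ab_group_add \<Rightarrow> 'e"
  assumes "lcHs s p" "\<And>e. e \<in> dual s (seminorm_topology UNIV UNIV p) \<Longrightarrow> e x = e y"
  shows "x = y"
proof -
  interpret seminorm_family s UNIV UNIV p
    by (rule lcHs_seminorm_family[OF assms(1)])
  have "p \<alpha> (x - y) = 0" for \<alpha>
  proof -
    have "vector_space s" "seminorm s (p \<alpha>)"
      using assms(1) by (auto simp: lcHs_def)
    then obtain e where e: "e \<in> polar s (p \<alpha>)" "norm (e (x - y)) = p \<alpha> (x - y)"
      by (rule polar_attains)
    have "e (x - y + y) = e (x - y) + e y"
      using e(1) unfolding polar_def by blast
    moreover have "e x = e y"
      using polar_subset_dual[OF assms(1)] e(1) by (intro assms(2)) blast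
    ultimately show ?thesis using e(2) by simp
  qed
  then have "x - y = 0"
    using assms(1) by (intro Hausdorff_imp_eq_zero) (auto simp: lcHs_def)
  then show ?thesis by simp
qed

text \<open>Alaoglu--Bourbaki: linearity is a family of closed pointwise conditions inside a product
  of balls, which is compact by Tychonoff's theorem.\<close>

lemma compact_polar:
  fixes s :: "'k::real_or_complex \<Rightarrow> 'e::ab_group_add \<Rightarrow> 'e"
  shows "compact (polar s q)"
proof -
  have "compactin (product_topology (\<lambda>_. euclidean) UNIV) (PiE UNIV (\<lambda>x. cball 0 (q x) :: 'k set))"
    by (simp add: compactin_PiE compact_cball_real_or_complex)
  then have "compact (PiE UNIV (\<lambda>x. cball 0 (q x) :: 'k set))"
    by (simp add: euclidean_product_topology)
  moreover have "closed {e :: 'e \<Rightarrow> 'k. \<forall>x y. e (x + y) = e x + e y}"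
    by (intro closed_Collect_all closed_Collect_eq continuous_intros continuous_on_product_coordinates)
  moreover have "closed {e :: 'e \<Rightarrow> 'k. \<forall>c x. e (s c x) = c * e x}"
    by (intro closed_Collect_all closed_Collect_eq continuous_intros continuous_on_product_coordinates)
  ultimately have "compact (PiE UNIV (\<lambda>x. cball 0 (q x) :: 'k set) \<inter>
      ({e :: 'e \<Rightarrow> 'k. \<forall>x y. e (x + y) = e x + e y} \<inter> {e. \<forall>c x. e (s c x) = c * e x}))"
    by (intro compact_Int_closed closed_Int)
  moreover have "\<dots> = polar s q"
    by (auto simp: polar_def)
  ultimately show ?thesis by simp
qed

lemma compactin_finite_net:
  assumes fam: "seminorm_family s V I q" and K: "compactin (seminorm_topology V I q) K"
    and "i \<in> I" "0 < r"
  obtains F where "finite F" "F \<subseteq> K" "\<And>x. x \<in> K \<Longrightarrow> \<exists>w\<in>F. q i (x - w) < r"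
proof -
  interpret seminorm_family s V I q by fact
  define B where "B w = {y \<in> V. q i (y - w) < r}" for w
  have "K \<subseteq> V"
    using K compactin_subset_topspace topspace_seminorm_topology by blast
  then have "\<forall>U\<in>B ` K. openin \<T> U"
    using \<open>i \<in> I\<close> by (auto simp: B_def intro: openin_ball)
  moreover have "K \<subseteq> \<Union>(B ` K)"
    using \<open>K \<subseteq> V\<close> \<open>i \<in> I\<close> \<open>0 < r\<close> by (auto simp: B_def q_zero)
  ultimately obtain \<F> where \<F>: "finite \<F>" "\<F> \<subseteq> B ` K" "K \<subseteq> \<Union>\<F>"
    using K unfolding compactin_def by meson
  then obtain F where "F \<subseteq> K" "finite F" "\<F> = B ` F"
    by (meson finite_subset_image)
  then show ?thesis using that[of F] \<F>(3) by (auto simp: B_def)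
qed

section \<open>The seminorms of the topology \<kappa>\<close>

lemma kappa_seminorm_le_iff:
  assumes "compactin X K" "\<phi> \<in> dual s X"
  shows "Sup (insert 0 ((\<lambda>x. norm (\<phi> x)) ` K)) \<le> b \<longleftrightarrow> 0 \<le> b \<and> (\<forall>x\<in>K. norm (\<phi> x) \<le> b)"
proof -
  have "continuous_map X euclideanreal (\<lambda>x. norm (\<phi> x))"
    using dualD(3)[OF assms(2)] by (rule continuous_map_norm)
  then have "compact ((\<lambda>x. norm (\<phi> x)) ` K)"
    using image_compactin[OF assms(1), of euclideanreal "\<lambda>x. norm (\<phi> x)"] by simp
  then have "bdd_above (insert 0 ((\<lambda>x. norm (\<phi> x)) ` K))"
    by (simp add: compact_imp_bounded bounded_imp_bdd_above)
  then show ?thesis by (subst cSup_le_iff) auto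
qed

lemma kappa_seminorm_family:
  fixes s :: "'k::real_normed_field \<Rightarrow> 'v::ab_group_add \<Rightarrow> 'v"
  shows "seminorm_family (fun_scale (*)) (dual s X) {K. abs_convex s K \<and> compactin X K}
    (\<lambda>K \<phi>. Sup (insert 0 ((\<lambda>x. norm (\<phi> x)) ` K)))" (is "seminorm_family _ _ ?I ?q")
proof -
  interpret vector_space "fun_scale (*) :: 'k \<Rightarrow> ('v \<Rightarrow> 'k) \<Rightarrow> 'v \<Rightarrow> 'k"
    by (intro vector_space_fun_scale vector_space_mult)
  note sub = subspace_dual[of s X]
  have bounds: "0 \<le> ?q K \<phi>" "x \<in> K \<Longrightarrow> norm (\<phi> x) \<le> ?q K \<phi>" if "K \<in> ?I" "\<phi> \<in> dual s X" for K \<phi> x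
    using that kappa_seminorm_le_iff[of X K \<phi> s "?q K \<phi>"] by auto
  have leI: "?q K \<phi> \<le> b" if "K \<in> ?I" "\<phi> \<in> dual s X" "0 \<le> b" "\<And>x. x \<in> K \<Longrightarrow> norm (\<phi> x) \<le> b" for K \<phi> b
    using that kappa_seminorm_le_iff[of X K \<phi> s b] by auto
  have scale_le: "?q K (fun_scale (*) c \<phi>) \<le> norm c * ?q K \<phi>" if "K \<in> ?I" "\<phi> \<in> dual s X" for K \<phi> c
  proof (rule leI)
    show "fun_scale (*) c \<phi> \<in> dual s X" using that sub subspace_scale by blast
    show "norm (fun_scale (*) c \<phi> x) \<le> norm c * ?q K \<phi>" if "x \<in> K" for x
      using bounds(2)[OF \<open>K \<in> ?I\<close> \<open>\<phi> \<in> dual s X\<close> that]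
      by (simp add: fun_scale_def norm_mult mult_left_mono)
  qed (use that bounds in auto)
  show ?thesis
  proof (rule seminorm_familyI)
    show "subspace (dual s X)" by (rule sub)
    have "{} \<in> ?I" by (simp add: abs_convex_def)
    then show "?I \<noteq> {}" by blast
    fix K \<phi> assume K: "K \<in> ?I" and \<phi>: "\<phi> \<in> dual s X"
    show "0 \<le> ?q K \<phi>" using bounds K \<phi> by blast
    show "?q K (\<phi> + \<psi>) \<le> ?q K \<phi> + ?q K \<psi>" if "\<psi> \<in> dual s X" for \<psi>
    proof (rule leI[OF K])
      show "\<phi> + \<psi> \<in> dual s X" using sub subspace_add \<phi> that by blast
      show "norm ((\<phi> + \<psi>) x) \<le> ?q K \<phi> + ?q K \<psi>" if "x \<in> K" for x
        using bounds(2)[OF K \<phi> that] bounds(2)[OF K \<open>\<psi> \<in> dual s X\<close> that]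
        by (simp add: norm_triangle_mono)
    qed (use bounds K \<phi> that in \<open>auto intro!: add_nonneg_nonneg\<close>)
    show "?q K (fun_scale (*) c \<phi>) \<le> norm c * ?q K \<phi>" for c
      using K \<phi> by (rule scale_le)
  qed unfold_locales
qed

lemma compactin_seminorm_bounded:
  assumes fam: "seminorm_family s V I q" and K: "compactin (seminorm_topology V I q) K" and i: "i \<in> I"
  obtains b where "\<And>x. x \<in> K \<Longrightarrow> q i x \<le> b"
proof -
  interpret seminorm_family s V I q by fact
  have "K \<subseteq> V"
    using K compactin_subset_topspace topspace_seminorm_topology by blast
  obtain F where F: "finite F" "F \<subseteq> K" "\<And>x. x \<in> K \<Longrightarrow> \<exists>w\<in>F. q i (x - w) < 1"
    using compactin_finite_net[OF fam K i, of 1] by auto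
  have "q i x \<le> 1 + (\<Sum>w\<in>F. q i w)" if x: "x \<in> K" for x
  proof -
    obtain w where w: "w \<in> F" "q i (x - w) < 1" using F(3)[OF x] by blast
    have "x \<in> V" "w \<in> V" using x w F(2) \<open>K \<subseteq> V\<close> by auto
    then have "q i x \<le> q i (x - w) + q i w"
      using q_add[OF i closed_ops(4), of x w w] by simp
    moreover have "q i w \<le> (\<Sum>w\<in>F. q i w)"
      using F w \<open>K \<subseteq> V\<close> q_nonneg i by (intro member_le_sum) auto
    ultimately show ?thesis using w by simp
  qed
  then show ?thesis by (rule that)
qed


subsection \<open>Transposes\<close>

text \<open>\<open>G\<close> stands for the map that extends \<open>e \<circ> f\<close> to the
  weighted space. \<open>compact_bound\<close> is its continuity on the dual of \<open>E\<close>
  with the topology \<kappa>, phrased with upper bounds \<open>b\<close> in place of a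
  supremum.\<close>

locale dual_map =
  fixes s :: "'k::real_or_complex \<Rightarrow> 'e::ab_group_add \<Rightarrow> 'e" and p :: "'a \<Rightarrow> 'e \<Rightarrow> real"
    and t :: "'k \<Rightarrow> 'v::ab_group_add \<Rightarrow> 'v" and V :: "'v set" and q :: "'i \<Rightarrow> 'v \<Rightarrow> real"
    and G :: "('e \<Rightarrow> 'k) \<Rightarrow> 'v"
  assumes E: "lcHs s p" and X: "seminorm_family t V UNIV q" and directed: "directed_seminorms V q"
    and maps: "e \<in> dual s (seminorm_topology UNIV UNIV p) \<Longrightarrow> G e \<in> V"
    and add: "e \<in> dual s (seminorm_topology UNIV UNIV p) \<Longrightarrow> e' \<in> dual s (seminorm_topology UNIV UNIV p) \<Longrightarrow>
      G (e + e') = G e + G e'"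
    and scale: "e \<in> dual s (seminorm_topology UNIV UNIV p) \<Longrightarrow> G (fun_scale (*) c e) = t c (G e)"
    and compact_bound: "\<exists>K. abs_convex s K \<and> compactin (seminorm_topology UNIV UNIV p) K \<and> K \<noteq> {} \<and>
      (\<forall>e \<in> dual s (seminorm_topology UNIV UNIV p). \<forall>b\<ge>0. (\<forall>z\<in>K. norm (e z) \<le> b) \<longrightarrow> q i (G e) \<le> b)"
begin

sublocale E: seminorm_family s UNIV UNIV p
  by (rule lcHs_seminorm_family[OF E])

sublocale X: seminorm_family t V UNIV q
  by (rule X)

lemma diff:
  assumes "e \<in> dual s E.\<T>" "e' \<in> dual s E.\<T>"
  shows "(\<lambda>x. e x - e' x) \<in> dual s E.\<T>" "G e - G e' = G (\<lambda>x. e x - e' x)"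
proof -
  interpret F: vector_space "fun_scale (*) :: 'k \<Rightarrow> ('e \<Rightarrow> 'k) \<Rightarrow> 'e \<Rightarrow> 'k"
    by (intro vector_space_fun_scale vector_space_mult)
  have *: "(\<lambda>x. e x - e' x) = e + fun_scale (*) (- 1) e'"
    by (simp add: fun_scale_def plus_fun_def)
  have e': "fun_scale (*) (- 1) e' \<in> dual s E.\<T>"
    using assms(2) F.subspace_scale subspace_dual by blast
  then show "(\<lambda>x. e x - e' x) \<in> dual s E.\<T>"
    unfolding * using assms(1) F.subspace_add subspace_dual by blast
  show "G e - G e' = G (\<lambda>x. e x - e' x)"
    unfolding * using add[OF assms(1) e'] scale[OF assms(2), of "- 1"] by simp
qed

text \<open>On the polar, which is equicontinuous, pointwise convergence is uniform on compact sets.\<close>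

lemma continuous_map_polar:
  "continuous_map (top_of_set (polar s (p \<alpha>))) X.\<T> G"
proof -
  let ?B = "polar s (p \<alpha>)"
  have B: "e \<in> dual s E.\<T>" if "e \<in> ?B" for e
    using polar_subset_dual[OF E] that by blast
  have "openin (top_of_set ?B) (G -` W \<inter> topspace (top_of_set ?B))"
    if W: "W \<in> {{y \<in> V. q i (y - x) < r} |x i r. x \<in> V \<and> i \<in> UNIV \<and> 0 < r}" for W
  proof -
    obtain x i r where x: "x \<in> V" and W: "W = {y \<in> V. q i (y - x) < r}"
      using W by blast
    obtain K where K: "compactin E.\<T> K"
      and bound: "\<And>e b. e \<in> dual s E.\<T> \<Longrightarrow> 0 \<le> b \<Longrightarrow> (\<And>z. z \<in> K \<Longrightarrow> norm (e z) \<le> b) \<Longrightarrow> q i (G e) \<le> b"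
      using compact_bound[of i] by metis
    have "\<exists>N. openin (top_of_set ?B) N \<and> e0 \<in> N \<and> N \<subseteq> G -` W \<inter> ?B" if e0: "e0 \<in> G -` W \<inter> ?B" for e0
    proof -
      define \<epsilon> where "\<epsilon> = r - q i (G e0 - x)"
      have "0 < \<epsilon>" using e0 by (simp add: W \<epsilon>_def)
      obtain F where F: "finite F" "F \<subseteq> K" and net: "\<And>z. z \<in> K \<Longrightarrow> \<exists>w\<in>F. p \<alpha> (z - w) < \<epsilon> / 6"
        using compactin_finite_net[OF E.seminorm_family_axioms K, of \<alpha> "\<epsilon> / 6"] \<open>0 < \<epsilon>\<close> by auto
      \<comment> \<open>Members of the polar vary by less than \<epsilon>/6 between \<open>z\<close>
        and a nearby net point, so closeness on the finite set \<open>F\<close> gives three errors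
        of \<epsilon>/6 on all of \<open>K\<close>. The resulting \<epsilon>/2 makes the final
        inequality strict.\<close>
      define O' where "O' = (\<Inter>w\<in>F. {e :: 'e \<Rightarrow> 'k. norm (e w - e0 w) < \<epsilon> / 6})"
      have "open O'"
        unfolding O'_def using F(1)
        by (intro open_INT ballI open_Collect_less continuous_intros continuous_on_product_coordinates)
      then have "openin (top_of_set ?B) (?B \<inter> O')" by (simp add: openin_open_Int)
      moreover have "e0 \<in> ?B \<inter> O'" using e0 \<open>0 < \<epsilon>\<close> by (simp add: O'_def)
      moreover have "e \<in> G -` W" if e: "e \<in> ?B \<inter> O'" for e
      proof -
        have dual: "e \<in> dual s E.\<T>" "e0 \<in> dual s E.\<T>" using e e0 B by auto
        have "norm (e z - e0 z) \<le> \<epsilon> / 2" if z: "z \<in> K" for z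
        proof -
          obtain w where w: "w \<in> F" "p \<alpha> (z - w) < \<epsilon> / 6" using net[OF z] by blast
          have lip: "norm (f z - f w) < \<epsilon> / 6" if "f \<in> ?B" for f
          proof -
            have "f (z - w + w) = f (z - w) + f w" "norm (f (z - w)) \<le> p \<alpha> (z - w)"
              using that unfolding polar_def by blast+
            then show ?thesis using w(2) by simp
          qed
          have "norm (e w - e0 w) < \<epsilon> / 6" using e w(1) by (simp add: O'_def)
          moreover have "e z - e0 z = (e z - e w) + (e w - e0 w) + (- (e0 z - e0 w))" by simp
          then have "norm (e z - e0 z) \<le> norm (e z - e w) + norm (e w - e0 w) + norm (e0 z - e0 w)"
            by (metis norm_minus_cancel norm_triangle_le norm_triangle_ineq add_right_mono)
          ultimately show ?thesis using lip[of e] lip[of e0] e e0 by simp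
        qed
        then have "q i (G e - G e0) \<le> \<epsilon> / 2"
          unfolding diff(2)[OF dual] using \<open>0 < \<epsilon>\<close> by (intro bound diff(1)[OF dual]) auto
        then have "q i (G e - x) < r"
          using X.q_triangle[of i "G e" "G e0" x] maps dual x \<open>0 < \<epsilon>\<close> by (simp add: \<epsilon>_def)
        then show ?thesis using maps dual by (simp add: W)
      qed
      ultimately show ?thesis by (intro exI[of _ "?B \<inter> O'"]) blast
    qed
    then have "openin (top_of_set ?B) (G -` W \<inter> ?B)"
      by (subst openin_subopen) blast
    then show ?thesis by simp
  qed
  moreover have "G ` topspace (top_of_set ?B) \<subseteq> \<Union>{{y \<in> V. q i (y - x) < r} |x i r. x \<in> V \<and> i \<in> UNIV \<and> 0 < r}"
    using X.topspace_seminorm_topology B maps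
    unfolding seminorm_topology_def topology_generated_by_topspace by auto
  ultimately show ?thesis
    unfolding seminorm_topology_def[of V UNIV q] by (rule continuous_on_generated_topo)
qed

text \<open>This makes the image of the polar an index of a seminorm of \<kappa> on the dual of
  \<open>V\<close>. Compactness comes from that of the polar under pointwise convergence, absolute
  convexity from the linearity of \<open>G\<close>.\<close>

lemma polar_image:
  shows "compactin X.\<T> (G ` polar s (p \<alpha>))" "abs_convex t (G ` polar s (p \<alpha>))"
proof -
  have "compactin (top_of_set (polar s (p \<alpha>))) (polar s (p \<alpha>))"
    by (simp add: compactin_subtopology compact_polar)
  then show "compactin X.\<T> (G ` polar s (p \<alpha>))"
    using continuous_map_polar by (rule image_compactin)
next
  interpret F: vector_space "fun_scale (*) :: 'k \<Rightarrow> ('e \<Rightarrow> 'k) \<Rightarrow> 'e \<Rightarrow> 'k"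
    by (intro vector_space_fun_scale vector_space_mult)
  have "t a (G e) + t b (G e') \<in> G ` polar s (p \<alpha>)"
    if e: "e \<in> polar s (p \<alpha>)" "e' \<in> polar s (p \<alpha>)" and ab: "norm a + norm b \<le> 1" for e e' a b
  proof -
    have dual: "e \<in> dual s E.\<T>" "e' \<in> dual s E.\<T>"
      using polar_subset_dual[OF E] e by blast+
    define g where "g = fun_scale (*) a e + fun_scale (*) b e'"
    have "t a (G e) + t b (G e') = G g"
      unfolding g_def using dual F.subspace_scale[OF subspace_dual] by (simp add: add scale)
    moreover have "norm (g x) \<le> p \<alpha> x" for x
    proof -
      have "norm (g x) \<le> norm a * norm (e x) + norm b * norm (e' x)"
        by (simp add: g_def fun_scale_def flip: norm_mult) (rule norm_triangle_ineq)
      also have "\<dots> \<le> norm a * p \<alpha> x + norm b * p \<alpha> x"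
        using e by (intro add_mono mult_left_mono) (auto simp: polar_def)
      also have "\<dots> \<le> p \<alpha> x"
        using mult_right_mono[OF ab, of "p \<alpha> x"] E.q_nonneg[of \<alpha> x] by (simp add: distrib_right)
      finally show ?thesis .
    qed
    then have "g \<in> polar s (p \<alpha>)"
      using e by (simp add: polar_def g_def fun_scale_def algebra_simps)
    ultimately show ?thesis by blast
  qed
  then show "abs_convex t (G ` polar s (p \<alpha>))"
    by (auto simp: abs_convex_def)
qed

text \<open>\<open>y\<close> is bounded by a multiple of one seminorm \<open>q i\<close>, hence the
  map from \<open>e\<close> to \<open>y (G e)\<close> by a multiple of the supremum of
  \<open>e\<close> over \<open>K\<close>; \<open>dual_system_solvable\<close> then represents it by
  a point.\<close>

lemma transpose_value:
  assumes y: "y \<in> dual t X.\<T>"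
  shows "\<exists>w. \<forall>e\<in>dual s E.\<T>. e w = y (G e)"
proof -
  obtain i C where C: "0 < C" "\<And>x. x \<in> V \<Longrightarrow> norm (y x) \<le> C * q i x"
    using dual_seminormD[OF X directed y] by metis
  obtain K where K: "abs_convex s K" "compactin E.\<T> K" "K \<noteq> {}"
    and bound: "\<And>e b. e \<in> dual s E.\<T> \<Longrightarrow> 0 \<le> b \<Longrightarrow> (\<And>z. z \<in> K \<Longrightarrow> norm (e z) \<le> b) \<Longrightarrow> q i (G e) \<le> b"
    using compact_bound[of i] by metis
  note y_lin = dualD(1,2)[OF y, unfolded X.topspace_seminorm_topology]
  \<comment> \<open>Dividing by \<open>C\<close> normalises the bound to \<open>K\<close> itself;
    the solution is multiplied by \<open>C\<close> at the end.\<close>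
  define \<phi> where "\<phi> e = y (G e) / of_real C" for e
  have "\<exists>z\<in>K. \<forall>e\<in>dual s E.\<T>. e z = \<phi> e"
  proof (rule dual_system_solvable[OF _ _ K])
    show "vector_space s" by unfold_locales
    show "topspace E.\<T> = UNIV" by (rule E.topspace_seminorm_topology)
    show "\<phi> (e + e') = \<phi> e + \<phi> e'" if "e \<in> dual s E.\<T>" "e' \<in> dual s E.\<T>" for e e'
      using that by (simp add: \<phi>_def add maps y_lin add_divide_distrib)
    show "\<phi> (fun_scale (*) c e) = c * \<phi> e" if "e \<in> dual s E.\<T>" for c e
      using that by (simp add: \<phi>_def scale maps y_lin)
    show "norm (\<phi> e) \<le> b" if "e \<in> dual s E.\<T>" "0 \<le> b" "\<And>z. z \<in> K \<Longrightarrow> norm (e z) \<le> b" for e b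
    proof -
      have "norm (y (G e)) \<le> C * q i (G e)" using that maps C by blast
      also have "\<dots> \<le> C * b" using bound[OF that] C by (intro mult_left_mono) auto
      finally show ?thesis using C by (simp add: \<phi>_def norm_divide pos_divide_le_eq mult.commute)
    qed
  qed
  then obtain z where z: "\<forall>e\<in>dual s E.\<T>. e z = \<phi> e" by blast
  have "e (s (of_real C) z) = y (G e)" if e: "e \<in> dual s E.\<T>" for e
    using bspec[OF z e] C dualD(2)[OF e, of z "of_real C"]
    by (simp add: \<phi>_def E.topspace_seminorm_topology)
  then show ?thesis by (intro exI[of _ "s (of_real C) z"] ballI)
qed

text \<open>The transpose is linear because the dual of \<open>E\<close> separates points. It is
  continuous because some \<open>e\<close> in the polar satisfies
  \<open>p \<alpha> (u y) = norm (y (G e))\<close>, and \<open>G e\<close> lies in the compact image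
  of the polar.\<close>

theorem transpose_eps_product:
  obtains u where "u \<in> eps_product t X.\<T> s E.\<T>"
    "\<And>e y. e \<in> dual s E.\<T> \<Longrightarrow> y \<in> dual t X.\<T> \<Longrightarrow> e (u y) = y (G e)"
proof -
  let ?I = "{K. abs_convex t K \<and> compactin X.\<T> K}"
  let ?q = "\<lambda>K \<phi>. Sup (insert 0 ((\<lambda>x. norm (\<phi> x)) ` K))"
  interpret \<kappa>: seminorm_family "fun_scale (*)" "dual t X.\<T>" ?I ?q
    by (rule kappa_seminorm_family)
  \<comment> \<open>The value 0 off the dual is the normalisation demanded by
    \<open>cont_lin\<close>.\<close>
  define u where "u y = (if y \<in> dual t X.\<T> then SOME w. \<forall>e\<in>dual s E.\<T>. e w = y (G e) else 0)" for y
  have u: "e (u y) = y (G e)" if "e \<in> dual s E.\<T>" "y \<in> dual t X.\<T>" for e y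
    using bspec[OF someI_ex[OF transpose_value[OF that(2)]] that(1)] that(2) by (simp add: u_def)
  have e_add: "e (x + x') = e x + e x'" and e_scale: "e (s c x) = c * e x"
    if "e \<in> dual s E.\<T>" for e x x' c
    using dualD(1,2)[OF that] by (simp_all add: E.topspace_seminorm_topology)
  have u_add: "u (y + y') = u y + u y'" if y: "y \<in> dual t X.\<T>" "y' \<in> dual t X.\<T>" for y y'
  proof (rule dual_separates[OF E])
    fix e assume e: "e \<in> dual s E.\<T>"
    show "e (u (y + y')) = e (u y + u y')"
      unfolding e_add[OF e] u[OF e y(1)] u[OF e y(2)] u[OF e \<kappa>.closed_ops(2)[OF y]] by simp
  qed
  have u_scale: "u (fun_scale (*) c y) = s c (u y)" if y: "y \<in> dual t X.\<T>" for c y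
  proof (rule dual_separates[OF E])
    fix e assume e: "e \<in> dual s E.\<T>"
    show "e (u (fun_scale (*) c y)) = e (s c (u y))"
      unfolding e_scale[OF e] u[OF e y] u[OF e \<kappa>.closed_ops(3)[OF y]] by (simp add: fun_scale_def)
  qed
  have u_bound: "p \<alpha> (u y) \<le> 1 * ?q (G ` polar s (p \<alpha>)) y" if y: "y \<in> dual t X.\<T>" for \<alpha> y
  proof -
    have "vector_space s" "seminorm s (p \<alpha>)" using E by (auto simp: lcHs_def)
    then obtain e where e: "e \<in> polar s (p \<alpha>)" "norm (e (u y)) = p \<alpha> (u y)"
      by (rule polar_attains)
    then have "p \<alpha> (u y) = norm (y (G e))"
      using u[OF _ y] polar_subset_dual[OF E] by (metis subsetD)
    also have "\<dots> \<le> ?q (G ` polar s (p \<alpha>)) y"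
      using kappa_seminorm_le_iff[OF polar_image(1) y] e(1) by blast
    finally show ?thesis by simp
  qed
  have "continuous_map \<kappa>.\<T> E.\<T> u"
  proof (rule continuous_map_seminormI[OF \<kappa>.seminorm_family_axioms E.seminorm_family_axioms])
    show "u y - u y' = u (y - y')" if "y \<in> dual t X.\<T>" "y' \<in> dual t X.\<T>" for y y'
      using u_add[of "y - y'" y'] \<kappa>.closed_ops(4) that by simp
    show "\<exists>K\<in>?I. \<exists>C>0. \<forall>y\<in>dual t X.\<T>. p \<alpha> (u y) \<le> C * ?q K y" for \<alpha>
      using u_bound polar_image by (intro bexI[of _ "G ` polar s (p \<alpha>)"] exI[of _ 1]) auto
  qed simp
  then have "u \<in> eps_product t X.\<T> s E.\<T>"
    using u_add u_scale
    unfolding eps_product_def cont_lin_def kappa_topology_def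
    by (simp add: \<kappa>.topspace_seminorm_topology) (simp add: u_def)
  then show ?thesis using that u by blast
qed

end


subsection \<open>Weighted spaces\<close>

lemma FV_seminorm_upper:
  assumes "f \<in> FV_space p \<omega> \<nu> D" "x \<in> \<omega> m"
  shows "p \<alpha> (opT D m f x) * \<nu> j m x \<le> FV_seminorm p \<omega> \<nu> D (j, m, \<alpha>) f"
  unfolding FV_seminorm_def prod.case
  using assms by (intro cSUP_upper) (auto simp: FV_space_def)

lemma FV_seminorm_family:
  fixes s :: "'k::real_normed_field \<Rightarrow> 'y::ab_group_add \<Rightarrow> 'y" and p :: "'a \<Rightarrow> 'y \<Rightarrow> real"
    and \<nu> :: "'j \<Rightarrow> 'm \<Rightarrow> 'w \<Rightarrow> real" and D :: "('o, 'm, 'w, 'y) operators"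
  assumes vs: "vector_space s" and p: "\<And>\<alpha>. seminorm s (p \<alpha>)"
    and w: "weight_functions \<omega> \<nu>" and lin: "linear_operators s \<omega> D"
  shows "seminorm_family (fun_scale s) (FV_space p \<omega> \<nu> D) UNIV (FV_seminorm p \<omega> \<nu> D)"
proof -
  interpret vector_space s by fact
  interpret F: vector_space "fun_scale s :: 'k \<Rightarrow> ('o \<Rightarrow> 'y) \<Rightarrow> 'o \<Rightarrow> 'y" by (rule vector_space_fun_scale[OF vs])
  let ?V = "FV_space p \<omega> \<nu> D" and ?q = "FV_seminorm p \<omega> \<nu> D"
  note upper = FV_seminorm_upper[of _ p \<omega> \<nu> D]
  have \<omega>: "\<omega> m \<noteq> {}" and \<nu>: "x \<in> \<omega> m \<Longrightarrow> 0 \<le> \<nu> j m x" for m j x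
    using w by (auto simp: weight_functions_def)
  have p_nonneg: "0 \<le> p \<alpha> z" and p_add: "p \<alpha> (z + z') \<le> p \<alpha> z + p \<alpha> z'"
    and p_scale: "p \<alpha> (s c z) = norm c * p \<alpha> z" for \<alpha> z z' c
    using p by (auto simp: seminorm_def)
  have p_zero: "p \<alpha> 0 = 0" for \<alpha>
    using p_scale[of \<alpha> 0 0] by simp
  have leastI: "?q (j, m, \<alpha>) f \<le> b" if "\<And>x. x \<in> \<omega> m \<Longrightarrow> p \<alpha> (opT D m f x) * \<nu> j m x \<le> b" for j m \<alpha> f b
    unfolding FV_seminorm_def prod.case using that \<omega> by (intro cSUP_least) auto
  have sub: "F.subspace (F_space D)"
    using lin unfolding F_space_def linear_operators_def
    by (intro F.subspace_inter F.subspace_Int) auto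
  have op_add: "opT D m (f + g) x = opT D m f x + opT D m g x"
    and op_scale: "opT D m (fun_scale s c f) x = s c (opT D m f x)"
    if "f \<in> F_space D" "g \<in> F_space D" "x \<in> \<omega> m" for f g m x c
    using lin that unfolding F_space_def linear_operators_def by auto
  have FV: "f \<in> F_space D" if "f \<in> ?V" for f using that by (simp add: FV_space_def)
  have FVI: "f \<in> ?V" if "f \<in> F_space D" "\<And>j m \<alpha> x. x \<in> \<omega> m \<Longrightarrow> p \<alpha> (opT D m f x) * \<nu> j m x \<le> b j m \<alpha>" for f b
    using that by (auto simp: FV_space_def intro!: bdd_aboveI2)
  \<comment> \<open>The pointwise estimates \<open>add_le\<close> and \<open>scale_le\<close> serve
    twice: they show that the space is closed under the operations, and they give the laws of the
    seminorms.\<close>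
  have add_le: "p \<alpha> (opT D m (f + g) x) * \<nu> j m x \<le> ?q (j, m, \<alpha>) f + ?q (j, m, \<alpha>) g"
    if "f \<in> ?V" "g \<in> ?V" "x \<in> \<omega> m" for f g x j m \<alpha>
  proof -
    have "p \<alpha> (opT D m (f + g) x) * \<nu> j m x \<le> (p \<alpha> (opT D m f x) + p \<alpha> (opT D m g x)) * \<nu> j m x"
      using that op_add[OF FV FV] \<nu> p_add by (intro mult_right_mono) auto
    also have "\<dots> \<le> ?q (j, m, \<alpha>) f + ?q (j, m, \<alpha>) g"
      using upper[OF that(1,3)] upper[OF that(2,3)] by (simp add: distrib_right add_mono)
    finally show ?thesis .
  qed
  have scale_le: "p \<alpha> (opT D m (fun_scale s c f) x) * \<nu> j m x \<le> norm c * ?q (j, m, \<alpha>) f"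
    if "f \<in> ?V" "x \<in> \<omega> m" for f x j m \<alpha> c
    using op_scale[OF FV FV] that upper[OF that] by (simp add: p_scale mult.assoc mult_left_mono)
  have op_zero: "opT D m 0 x = 0" if "x \<in> \<omega> m" for m x
    using op_scale[of 0 0 x m 0] that F.subspace_0[OF sub] by simp
  show ?thesis
  proof (rule seminorm_familyI)
    show "F.subspace ?V"
    proof (rule F.subspaceI)
      show "0 \<in> ?V"
        using F.subspace_0[OF sub] by (rule FVI[of 0 "\<lambda>_ _ _. 0"]) (simp add: op_zero p_zero)
      show "f + g \<in> ?V" if "f \<in> ?V" "g \<in> ?V" for f g
        using F.subspace_add[OF sub FV[OF that(1)] FV[OF that(2)]] add_le[OF that] by (rule FVI)
      show "fun_scale s c f \<in> ?V" if "f \<in> ?V" for f c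
        using F.subspace_scale[OF sub FV[OF that]] scale_le[OF that] by (rule FVI)
    qed
    fix i :: "'j \<times> 'm \<times> 'a" and f assume f: "f \<in> ?V"
    obtain j m \<alpha> where i: "i = (j, m, \<alpha>)" by (cases i)
    obtain x where x: "x \<in> \<omega> m" using \<omega> by blast
    have "0 \<le> p \<alpha> (opT D m f x) * \<nu> j m x" using p_nonneg \<nu>[OF x] by simp
    then show "0 \<le> ?q i f" unfolding i using upper[OF f x] by (rule order_trans)
    show "?q i (f + g) \<le> ?q i f + ?q i g" if "g \<in> ?V" for g
      unfolding i using add_le[OF f that] by (rule leastI)
    show "?q i (fun_scale s c f) \<le> norm c * ?q i f" for c
      unfolding i using scale_le[OF f] by (rule leastI)
  qed (use F.vector_space_axioms in auto)
qed

text \<open>The semi-Montel property makes closures of bounded sets compact, and these sets are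
  already closed.\<close>

lemma semi_Montel_compactin:
  assumes "semi_Montel s p"
  shows "compactin (seminorm_topology UNIV UNIV p) {z. \<forall>\<alpha>. p \<alpha> z \<le> c \<alpha>}"
proof -
  interpret seminorm_family s UNIV UNIV p
    using assms by (intro lcHs_seminorm_family) (simp add: semi_Montel_def)
  have "closedin \<T> {z. \<forall>\<alpha>. p \<alpha> z \<le> c \<alpha>}"
    using closedin_seminorm_le[of c] by simp
  moreover have "bounded_in p {z. \<forall>\<alpha>. p \<alpha> z \<le> c \<alpha>}"
    by (auto simp: bounded_in_def intro!: bdd_aboveI2)
  ultimately show ?thesis
    using assms unfolding semi_Montel_def by (metis closure_of_closedin)
qed

lemma abs_convex_seminorm_le:
  fixes s :: "'k::real_normed_field \<Rightarrow> 'e::ab_group_add \<Rightarrow> 'e"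
  assumes "\<And>\<alpha>. seminorm s (p \<alpha>)"
  shows "abs_convex s {z. \<forall>\<alpha>. p \<alpha> z \<le> c \<alpha>}"
  unfolding abs_convex_def
proof (intro ballI allI impI)
  fix x y and a b :: 'k assume x: "x \<in> {z. \<forall>\<alpha>. p \<alpha> z \<le> c \<alpha>}" and y: "y \<in> {z. \<forall>\<alpha>. p \<alpha> z \<le> c \<alpha>}"
    and ab: "norm a + norm b \<le> 1"
  have "p \<alpha> (s a x + s b y) \<le> c \<alpha>" for \<alpha>
  proof -
    have "p \<alpha> (s a x + s b y) \<le> norm a * p \<alpha> x + norm b * p \<alpha> y"
      using assms unfolding seminorm_def by metis
    also have "\<dots> \<le> norm a * c \<alpha> + norm b * c \<alpha>"
      using x y by (intro add_mono mult_left_mono) auto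
    also have "\<dots> \<le> 1 * c \<alpha>"
    proof -
      \<comment> \<open>The point \<open>x\<close> itself shows that \<open>c \<alpha>\<close> is
        nonnegative, which the monotonicity of multiplication requires.\<close>
      have "0 \<le> p \<alpha> x" "p \<alpha> x \<le> c \<alpha>" using assms x by (auto simp: seminorm_def)
      then have "(norm a + norm b) * c \<alpha> \<le> 1 * c \<alpha>"
        using ab by (intro mult_right_mono) auto
      then show ?thesis by (simp add: distrib_right)
    qed
    finally show ?thesis by simp
  qed
  then show "s a x + s b y \<in> {z. \<forall>\<alpha>. p \<alpha> z \<le> c \<alpha>}" by simp
qed

section \<open>Strong consistent generators and the restriction map\<close>

locale consistent_strong_generator =
  fixes s :: "'k::real_or_complex \<Rightarrow> 'e::ab_group_add \<Rightarrow> 'e"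
    and p :: "'a \<Rightarrow> 'e \<Rightarrow> real"
    and \<omega> :: "'m \<Rightarrow> 'w set"
    and \<nu> :: "'j \<Rightarrow> 'm \<Rightarrow> 'w \<Rightarrow> real"
    and DE :: "('o, 'm, 'w, 'e) operators"
    and DK :: "('o, 'm, 'w, 'k) operators"
  assumes E: "lcHs s p" and generator: "generator s p \<omega> \<nu> DE DK"
    and strong: "strong s p \<omega> \<nu> DE DK" and consistent: "consistent s p \<omega> \<nu> DE DK"
begin

abbreviation "V \<equiv> FV_space scalar_norm \<omega> \<nu> DK"
abbreviation "Q \<equiv> FV_seminorm scalar_norm \<omega> \<nu> DK"
abbreviation "\<T>E \<equiv> seminorm_topology UNIV UNIV p"

sublocale E: seminorm_family s UNIV UNIV p
  by (rule lcHs_seminorm_family[OF E])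

lemma weights: "weight_functions \<omega> \<nu>" and linear_DK: "linear_operators (*) \<omega> DK"
  using generator by (auto simp: generator_def)

sublocale X: seminorm_family "fun_scale (*)" V UNIV Q
  using weights linear_DK
  by (intro FV_seminorm_family vector_space_mult) (auto simp: seminorm_def norm_triangle_ineq norm_mult)

lemma weight_nonneg: "x \<in> \<omega> m \<Longrightarrow> 0 \<le> \<nu> j m x"
  using weights by (auto simp: weight_functions_def)

lemma directed_DK: "directed_seminorms V Q" and Hausdorff_DK: "Hausdorff_space X.\<T>"
  using generator by (auto simp: generator_def scalar_dom_space_def dom_space_def FV_topology_def)

lemma op_linear:
  assumes "f \<in> V" "g \<in> V" "x \<in> \<omega> m"
  shows "opT DK m (f + g) x = opT DK m f x + opT DK m g x"
    "opT DK m (fun_scale (*) c f) x = c * opT DK m f x"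
    "opT DK m (f - g) x = opT DK m f x - opT DK m g x"
proof -
  have mem: "f \<in> domT DK m" if "f \<in> V" for f
    using that by (simp add: FV_space_def F_space_def)
  have add: "opT DK m (f + g) x = opT DK m f x + opT DK m g x" if "f \<in> V" "g \<in> V" for f g
    using linear_DK mem that assms(3) by (simp add: linear_operators_def)
  show "opT DK m (f + g) x = opT DK m f x + opT DK m g x"
    using add assms by blast
  show "opT DK m (fun_scale (*) c f) x = c * opT DK m f x"
    using linear_DK mem assms by (simp add: linear_operators_def)
  show "opT DK m (f - g) x = opT DK m f x - opT DK m g x"
    using add[OF X.closed_ops(4)[OF assms(1,2)] assms(2)] by simp
qed

lemma op_bound: "f \<in> V \<Longrightarrow> x \<in> \<omega> m \<Longrightarrow> norm (opT DK m f x) * \<nu> j m x \<le> Q (j, m, ()) f"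
  using FV_seminorm_upper[of f scalar_norm \<omega> \<nu> DK x m] by simp

lemma op_functional_apply: "f \<in> V \<Longrightarrow> op_functional \<omega> \<nu> DK m x f = opT DK m f x"
  by (simp add: op_functional_def zero_outside_def)

text \<open>Some weight is positive at \<open>x\<close>, and division by it bounds the functional by
  a multiple of a seminorm.\<close>

lemma op_functional_in_dual:
  assumes x: "x \<in> \<omega> m"
  shows "op_functional \<omega> \<nu> DK m x \<in> dual (fun_scale (*)) X.\<T>"
proof -
  obtain j where j: "0 < \<nu> j m x"
    using weights x unfolding weight_functions_def by blast
  show ?thesis
  proof (rule dual_seminormI[OF X.seminorm_family_axioms])
    show "0 < 1 / \<nu> j m x" using j by simp
    show "norm (op_functional \<omega> \<nu> DK m x f) \<le> 1 / \<nu> j m x * Q (j, m, ()) f" if "f \<in> V" for f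
      using op_bound[OF that x, of j] j by (simp add: op_functional_apply[OF that] field_simps)
    show "op_functional \<omega> \<nu> DK m x f = 0" if "f \<notin> V" for f
      using that by (simp add: op_functional_def zero_outside_def)
  qed (simp_all add: op_functional_apply X.closed_ops op_linear x)
qed

lemma eps_product_value:
  assumes u: "u \<in> FV_eps s p \<omega> \<nu> DK" and x: "x \<in> \<omega> m"
  shows "opT DE m (S_map \<omega> \<nu> DK u) x = u (op_functional \<omega> \<nu> DK m x)"
  using consistent u x by (simp add: consistent_def)

text \<open>Consistency gives membership in \<open>F_space DE\<close> only. The seminorms are finite
  because \<open>u\<close> is continuous and, for fixed \<open>j\<close> and \<open>m\<close>, the
  weighted functionals at all points of \<open>\<omega> m\<close> are uniformly bounded on each
  compact set.\<close>

lemma S_map_in_FV_space: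
  assumes u: "u \<in> FV_eps s p \<omega> \<nu> DK"
  shows "S_map \<omega> \<nu> DK u \<in> FV_space p \<omega> \<nu> DE"
proof -
  let ?D = "dual (fun_scale (*)) X.\<T>"
  let ?I = "{K. abs_convex (fun_scale (*)) K \<and> compactin X.\<T> K}"
  let ?q = "\<lambda>K \<phi>. Sup (insert 0 ((\<lambda>x. norm (\<phi> x)) ` K))"
  let ?T = "op_functional \<omega> \<nu> DK"
  interpret \<kappa>: seminorm_family "fun_scale (*)" ?D ?I ?q
    by (rule kappa_seminorm_family)
  have cont: "continuous_map \<kappa>.\<T> \<T>E u" and scale: "\<And>c y. y \<in> ?D \<Longrightarrow> u (fun_scale (*) c y) = s c (u y)"
    using u \<kappa>.topspace_seminorm_topology
    by (auto simp: FV_eps_def eps_product_def cont_lin_def kappa_topology_def FV_topology_def)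
  have "\<exists>b. \<forall>x\<in>\<omega> m. p \<alpha> (u (?T m x)) * \<nu> j m x \<le> b" for j m \<alpha>
  proof -
    have "\<exists>F C. finite F \<and> F \<subseteq> ?I \<and> 0 < C \<and> (\<forall>y\<in>?D. p \<alpha> (u y) \<le> C * (\<Sum>K\<in>F. ?q K y))"
      by (rule continuous_map_seminormD[OF \<kappa>.seminorm_family_axioms E.seminorm_family_axioms cont])
        (simp_all add: scale)
    then obtain F C where F: "finite F" "F \<subseteq> ?I" "0 < C"
      and bound: "\<And>y. y \<in> ?D \<Longrightarrow> p \<alpha> (u y) \<le> C * (\<Sum>K\<in>F. ?q K y)"
      by (elim exE conjE) (rule that, auto)
    have "\<exists>b\<ge>0. \<forall>g\<in>K. Q (j, m, ()) g \<le> b" if K: "K \<in> F" for K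
    proof -
      have "compactin X.\<T> K" using K F by blast
      then obtain b where "\<And>g. g \<in> K \<Longrightarrow> Q (j, m, ()) g \<le> b"
        using compactin_seminorm_bounded[OF X.seminorm_family_axioms _ UNIV_I] by metis
      \<comment> \<open>The supremum that defines a seminorm of \<kappa> includes 0, so the bound
        has to be nonnegative.\<close>
      then show ?thesis by (intro exI[of _ "max 0 b"]) fastforce
    qed
    then obtain b where b: "\<And>K. K \<in> F \<Longrightarrow> 0 \<le> b K" "\<And>K g. K \<in> F \<Longrightarrow> g \<in> K \<Longrightarrow> Q (j, m, ()) g \<le> b K"
      by metis
    have "p \<alpha> (u (?T m x)) * \<nu> j m x \<le> C * (\<Sum>K\<in>F. b K)" if x: "x \<in> \<omega> m" for x
    proof -
      \<comment> \<open>The weight is absorbed into the functional, whose values are then bounded by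
        \<open>Q (j, m, ())\<close> independently of \<open>x\<close>.\<close>
      let ?y = "fun_scale (*) (of_real (\<nu> j m x)) (?T m x)"
      have y: "?y \<in> ?D" using op_functional_in_dual[OF x] by (rule \<kappa>.closed_ops)
      have "p \<alpha> (u (?T m x)) * \<nu> j m x = p \<alpha> (u ?y)"
        using scale[OF op_functional_in_dual[OF x]] weight_nonneg[OF x] by (simp add: E.q_scale)
      also have "\<dots> \<le> C * (\<Sum>K\<in>F. ?q K ?y)" by (rule bound[OF y])
      also have "\<dots> \<le> C * (\<Sum>K\<in>F. b K)"
      proof (intro mult_left_mono sum_mono)
        fix K assume K: "K \<in> F"
        have comp: "compactin X.\<T> K" using K F by blast
        have "norm (?y g) \<le> b K" if g: "g \<in> K" for g
        proof -
          have "g \<in> V"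
            using compactin_subset_topspace[OF comp] g X.topspace_seminorm_topology by blast
          then have "norm (?y g) \<le> Q (j, m, ()) g"
            using op_bound[OF _ x, of g j] weight_nonneg[OF x]
            by (simp add: fun_scale_def op_functional_apply norm_mult mult.commute)
          also have "\<dots> \<le> b K" by (rule b(2)[OF K g])
          finally show ?thesis .
        qed
        then show "?q K ?y \<le> b K"
          using kappa_seminorm_le_iff[OF comp y] b(1)[OF K] by blast
      qed (use F in simp)
      finally show ?thesis .
    qed
    then show ?thesis by blast
  qed
  then have "bdd_above ((\<lambda>x. p \<alpha> (opT DE m (S_map \<omega> \<nu> DK u) x) * \<nu> j m x) ` \<omega> m)" for j m \<alpha>
    by (simp add: bdd_above_def eps_product_value[OF u])
  moreover have "S_map \<omega> \<nu> DK u \<in> F_space DE"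
    using consistent u by (simp add: consistent_def)
  ultimately show ?thesis by (simp add: FV_space_def)
qed

text \<open>Strength gives membership in \<open>F_space DK\<close> and the exchange with the
  operators; the seminorms are finite because \<open>e\<close> is dominated by a multiple of a
  single \<open>p \<alpha>\<close>.\<close>

lemma dual_compose_in_FV_space:
  assumes e: "e \<in> dual s \<T>E" and f: "f \<in> FV_space p \<omega> \<nu> DE"
  shows "e \<circ> f \<in> V" "x \<in> \<omega> m \<Longrightarrow> opT DK m (e \<circ> f) x = e (opT DE m f x)"
proof -
  have F: "e \<circ> f \<in> F_space DK" and op: "\<And>m x. x \<in> \<omega> m \<Longrightarrow> opT DK m (e \<circ> f) x = e (opT DE m f x)"
    using strong e f by (auto simp: strong_def)
  have "directed_seminorms UNIV p" using E by (simp add: lcHs_def)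
  then obtain \<alpha> C where C: "0 < C" "\<And>z. norm (e z) \<le> C * p \<alpha> z"
    using dual_seminormD[OF E.seminorm_family_axioms _ e] by (metis UNIV_I)
  have "norm (opT DK m (e \<circ> f) x) * \<nu> j m x \<le> C * FV_seminorm p \<omega> \<nu> DE (j, m, \<alpha>) f" if x: "x \<in> \<omega> m" for j m x
  proof -
    have "norm (opT DK m (e \<circ> f) x) * \<nu> j m x \<le> C * p \<alpha> (opT DE m f x) * \<nu> j m x"
      unfolding op[OF x] using C weight_nonneg[OF x] by (intro mult_right_mono) auto
    also have "\<dots> \<le> C * FV_seminorm p \<omega> \<nu> DE (j, m, \<alpha>) f"
      using FV_seminorm_upper[OF f x] C by (simp add: mult.assoc)
    finally show ?thesis .
  qed
  then show "e \<circ> f \<in> V"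
    using F by (auto simp: FV_space_def intro!: bdd_aboveI2)
  show "x \<in> \<omega> m \<Longrightarrow> opT DK m (e \<circ> f) x = e (opT DE m f x)"
    by (rule op)
qed

text \<open>The extension required for \<open>e\<close> is \<open>e \<circ> f\<close>. Together with
  \<open>S_map_in_FV_space\<close> this shows that the restriction map takes values in the stated
  space.\<close>

lemma restriction_in_FV_dual_space_lb:
  assumes U: "U \<subseteq> Sigma UNIV \<omega>" and f: "f \<in> FV_space p \<omega> \<nu> DE"
  shows "restriction_map DE U f \<in> FV_dual_space_lb s p \<omega> \<nu> DK U"
proof -
  have "\<exists>g\<in>V. \<forall>(m, x)\<in>U. opT DK m g x = e (restriction_map DE U f (m, x))" if e: "e \<in> dual s \<T>E" for e
    using U dual_compose_in_FV_space[OF e f]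
    by (intro bexI[of _ "e \<circ> f"]) (auto simp: restriction_map_def)
  moreover have "bounded_in p {s (of_real (\<nu> j m x)) (restriction_map DE U f (m, x)) |x. x \<in> \<omega> m \<and> (m, x) \<in> U}" for j m
    unfolding bounded_in_def
  proof
    fix \<alpha>
    have "p \<alpha> (s (of_real (\<nu> j m x)) (restriction_map DE U f (m, x))) \<le> FV_seminorm p \<omega> \<nu> DE (j, m, \<alpha>) f"
      if "x \<in> \<omega> m" "(m, x) \<in> U" for x
      using FV_seminorm_upper[OF f that(1), of \<alpha> j] that weight_nonneg[OF that(1)]
      by (simp add: restriction_map_def E.q_scale mult.commute)
    then show "bdd_above (p \<alpha> ` {s (of_real (\<nu> j m x)) (restriction_map DE U f (m, x)) |x. x \<in> \<omega> m \<and> (m, x) \<in> U})"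
      by (intro bdd_aboveI2) blast
  qed
  ultimately show ?thesis
    by (simp add: FV_dual_space_lb_def FV_dual_space_def) (simp add: restriction_map_def)
qed

text \<open>The operators send the difference to 0 on \<open>U\<close>, so each of its seminorms is
  at most a multiple of 0, and the space is Hausdorff.\<close>

lemma fixes_topology_unique:
  assumes U: "fixes_topology \<omega> \<nu> DK U" and fg: "f \<in> V" "g \<in> V"
    and eq: "\<And>m x. (m, x) \<in> U \<Longrightarrow> opT DK m f x = opT DK m g x"
  shows "f = g"
proof -
  have h: "f - g \<in> V" using fg by (rule X.closed_ops)
  have zero: "opT DK m (f - g) x = 0" if "(m, x) \<in> U" "x \<in> \<omega> m" for m x
    using op_linear(3)[OF fg that(2)] eq[OF that(1)] by simp
  have "Q i (f - g) = 0" for i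
  proof -
    obtain j m where i: "i = (j, m, ())" by (metis old.unit.exhaust prod.exhaust)
    obtain l k C where "0 < C" and le: "Q (j, m, ()) (f - g) \<le>
          C * Sup (insert 0 ((\<lambda>x. norm (opT DK k (f - g) x) * \<nu> l k x) ` {x \<in> \<omega> k. (k, x) \<in> U}))"
      using U h unfolding fixes_topology_def by blast
    \<comment> \<open>The inserted 0 also covers an empty slice of \<open>U\<close>.\<close>
    have *: "insert 0 ((\<lambda>x. norm (opT DK k (f - g) x) * \<nu> l k x) ` {x \<in> \<omega> k. (k, x) \<in> U}) = {0}"
      using zero by auto
    have "Q i (f - g) \<le> 0" using le unfolding * i by simp
    then show ?thesis using X.q_nonneg[OF UNIV_I h, of i] by simp
  qed
  then have "f - g = 0"
    using Hausdorff_DK h by (intro X.Hausdorff_imp_eq_zero) auto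
  then show ?thesis by simp
qed

lemma restriction_surjective:
  assumes Montel: "semi_Montel s p" and U: "fixes_topology \<omega> \<nu> DK U"
    and f: "f \<in> FV_dual_space_lb s p \<omega> \<nu> DK U"
  shows "\<exists>u \<in> FV_eps s p \<omega> \<nu> DK. restriction_map DE U (S_map \<omega> \<nu> DK u) = f"
proof -
  have U_sub: "x \<in> \<omega> m" if "(m, x) \<in> U" for m x
    using U that by (auto simp: fixes_topology_def)
  have "\<forall>e\<in>dual s \<T>E. \<exists>g\<in>V. \<forall>m x. (m, x) \<in> U \<longrightarrow> opT DK m g x = e (f (m, x))"
    using f by (fastforce simp: FV_dual_space_lb_def FV_dual_space_def)
  then obtain G where GV: "\<And>e. e \<in> dual s \<T>E \<Longrightarrow> G e \<in> V"
    and G: "\<And>e m x. e \<in> dual s \<T>E \<Longrightarrow> (m, x) \<in> U \<Longrightarrow> opT DK m (G e) x = e (f (m, x))"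
    by metis
  interpret F: vector_space "fun_scale (*) :: 'k \<Rightarrow> ('e \<Rightarrow> 'k) \<Rightarrow> 'e \<Rightarrow> 'k"
    by (intro vector_space_fun_scale vector_space_mult)
  \<comment> \<open>The extensions were chosen arbitrarily; additivity and homogeneity of
    \<open>G\<close> come from \<open>fixes_topology_unique\<close>, since both sides agree on
    \<open>U\<close>.\<close>
  interpret dual_map s p "fun_scale (*)" V Q G
  proof (rule dual_map.intro)
    show "lcHs s p" "seminorm_family (fun_scale (*)) V UNIV Q" "directed_seminorms V Q"
      by (rule E X.seminorm_family_axioms directed_DK)+
    fix e assume e: "e \<in> dual s \<T>E"
    show "G e \<in> V" by (rule GV[OF e])
    show "G (e + e') = G e + G e'" if e': "e' \<in> dual s \<T>E" for e'
    proof (rule fixes_topology_unique[OF U])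
      have sum: "e + e' \<in> dual s \<T>E"
        using e e' F.subspace_add subspace_dual by blast
      show "G (e + e') \<in> V" "G e + G e' \<in> V"
        using GV sum e e' X.closed_ops(2) by auto
      show "opT DK m (G (e + e')) x = opT DK m (G e + G e') x" if mx: "(m, x) \<in> U" for m x
        by (simp add: op_linear(1)[OF GV[OF e] GV[OF e'] U_sub[OF mx]] G[OF _ mx] e e' sum)
    qed
    show "G (fun_scale (*) c e) = fun_scale (*) c (G e)" for c
    proof (rule fixes_topology_unique[OF U])
      have scaled: "fun_scale (*) c e \<in> dual s \<T>E"
        using e F.subspace_scale subspace_dual by blast
      show "G (fun_scale (*) c e) \<in> V" "fun_scale (*) c (G e) \<in> V"
        using GV scaled e X.closed_ops(3) by auto
      show "opT DK m (G (fun_scale (*) c e)) x = opT DK m (fun_scale (*) c (G e)) x" if mx: "(m, x) \<in> U" for m x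
        unfolding op_linear(2)[OF GV[OF e] GV[OF e] U_sub[OF mx]] G[OF e mx] G[OF scaled mx]
        by (simp add: fun_scale_def)
    qed
  next
    fix i :: "'j \<times> 'm \<times> unit"
    obtain j m where i: "i = (j, m, ())" by (metis old.unit.exhaust prod.exhaust)
    obtain l k C where C: "0 < C" and le: "\<forall>g\<in>V. Q (j, m, ()) g \<le>
        C * Sup (insert 0 ((\<lambda>x. norm (opT DK k g x) * \<nu> l k x) ` {x \<in> \<omega> k. (k, x) \<in> U}))"
      using U unfolding fixes_topology_def by blast
    have "\<exists>b\<ge>0. \<forall>x. x \<in> \<omega> k \<and> (k, x) \<in> U \<longrightarrow> p \<alpha> (s (of_real (\<nu> l k x)) (f (k, x))) \<le> b" for \<alpha>
    proof -
      have "bdd_above (p \<alpha> ` {s (of_real (\<nu> l k x)) (f (k, x)) |x. x \<in> \<omega> k \<and> (k, x) \<in> U})"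
        using f by (simp add: FV_dual_space_lb_def bounded_in_def)
      then obtain b where "\<And>x. x \<in> \<omega> k \<Longrightarrow> (k, x) \<in> U \<Longrightarrow> p \<alpha> (s (of_real (\<nu> l k x)) (f (k, x))) \<le> b"
        unfolding bdd_above_def by blast
      \<comment> \<open>Nonnegative bounds ensure that 0 lies in \<open>K\<close> below, also when
        the slice of \<open>U\<close> is empty.\<close>
      then show ?thesis by (intro exI[of _ "max 0 b"]) fastforce
    qed
    then obtain b where b: "\<And>\<alpha>. 0 \<le> b \<alpha>"
      "\<And>\<alpha> x. x \<in> \<omega> k \<Longrightarrow> (k, x) \<in> U \<Longrightarrow> p \<alpha> (s (of_real (\<nu> l k x)) (f (k, x))) \<le> b \<alpha>"
      by metis
    \<comment> \<open>The factor \<open>C\<close> of the fixing condition is built into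
      \<open>K\<close>: the weighted values of \<open>f\<close>, multiplied by \<open>C\<close>, lie
      in \<open>K\<close>. A bound \<open>c\<close> for \<open>e\<close> on \<open>K\<close> thus
      becomes \<open>c / C\<close> for the weighted values of \<open>G e\<close>, and the fixing
      condition returns \<open>c\<close>.\<close>
    define K where "K = {z. \<forall>\<alpha>. p \<alpha> z \<le> C * b \<alpha>}"
    have "abs_convex s K" "compactin \<T>E K"
      unfolding K_def using E by (auto intro!: abs_convex_seminorm_le semi_Montel_compactin[OF Montel] simp: lcHs_def)
    moreover have "0 \<in> K" using b(1) C by (simp add: K_def E.q_zero)
    moreover have "Q i (G e) \<le> c" if e: "e \<in> dual s \<T>E" and "0 \<le> c" and c: "\<And>z. z \<in> K \<Longrightarrow> norm (e z) \<le> c" for e c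
    proof -
      have "norm (opT DK k (G e) x) * \<nu> l k x \<le> c / C" if x: "x \<in> \<omega> k" "(k, x) \<in> U" for x
      proof -
        let ?z = "s (of_real (C * \<nu> l k x)) (f (k, x))"
        have "p \<alpha> ?z \<le> C * b \<alpha>" for \<alpha>
          using b(2)[OF x, of \<alpha>] C weight_nonneg[OF x(1), of l] by (simp add: E.q_scale norm_mult)
        then have "norm (e ?z) \<le> c" by (intro c) (simp add: K_def)
        moreover have "e ?z = of_real (C * \<nu> l k x) * e (f (k, x))"
          using dualD(2)[OF e] E.topspace_seminorm_topology by blast
        ultimately have "C * \<nu> l k x * norm (opT DK k (G e) x) \<le> c"
          using C weight_nonneg[OF x(1), of l] by (simp add: G[OF e x(2)] norm_mult)
        then show ?thesis using C by (simp add: field_simps)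
      qed
      then have "Sup (insert 0 ((\<lambda>x. norm (opT DK k (G e) x) * \<nu> l k x) ` {x \<in> \<omega> k. (k, x) \<in> U})) \<le> c / C"
        using C \<open>0 \<le> c\<close> by (intro cSup_least) auto
      then have "C * Sup (insert 0 ((\<lambda>x. norm (opT DK k (G e) x) * \<nu> l k x) ` {x \<in> \<omega> k. (k, x) \<in> U})) \<le> c"
        using C by (simp add: pos_le_divide_eq mult.commute)
      then show ?thesis using bspec[OF le GV[OF e]] by (simp add: i)
    qed
    ultimately show "\<exists>K. abs_convex s K \<and> compactin \<T>E K \<and> K \<noteq> {} \<and>
      (\<forall>e \<in> dual s \<T>E. \<forall>b\<ge>0. (\<forall>z\<in>K. norm (e z) \<le> b) \<longrightarrow> Q i (G e) \<le> b)"
      by (intro exI[of _ K]) auto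
  qed
  obtain u where u: "u \<in> FV_eps s p \<omega> \<nu> DK"
    and val: "\<And>e y. e \<in> dual s \<T>E \<Longrightarrow> y \<in> dual (fun_scale (*)) X.\<T> \<Longrightarrow> e (u y) = y (G e)"
    using transpose_eps_product unfolding FV_eps_def FV_topology_def by metis
  \<comment> \<open>Consistency turns the left side into \<open>u\<close> at an operator functional;
    paired with \<open>e\<close>, this is the operator applied to \<open>G e\<close>, which is
    \<open>e (f (m, x))\<close> on \<open>U\<close>.\<close>
  have "opT DE m (S_map \<omega> \<nu> DK u) x = f (m, x)" if mx: "(m, x) \<in> U" for m x
  proof (rule dual_separates[OF E])
    fix e assume e: "e \<in> dual s \<T>E"
    show "e (opT DE m (S_map \<omega> \<nu> DK u) x) = e (f (m, x))"
      unfolding eps_product_value[OF u U_sub[OF mx]] val[OF e op_functional_in_dual[OF U_sub[OF mx]]]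
        op_functional_apply[OF GV[OF e]] by (rule G[OF e mx])
  qed
  moreover have "f \<in> extensional U"
    using f by (simp add: FV_dual_space_lb_def FV_dual_space_def)
  ultimately have "restriction_map DE U (S_map \<omega> \<nu> DK u) = f"
    by (auto simp: restriction_map_def restrict_def extensional_def fun_eq_iff)
  with u show ?thesis by blast
qed

end

text \<open>Equality of the two sets expresses both that the restriction map has values in the
  stated space and that it is onto.\<close>

theorem theorem5p2p52:
  fixes s :: "'k::real_or_complex \<Rightarrow> 'e::ab_group_add \<Rightarrow> 'e"
    and p :: "'a \<Rightarrow> 'e \<Rightarrow> real"
    and \<omega> :: "'m \<Rightarrow> 'w set"
    and \<nu> :: "'j \<Rightarrow> 'm \<Rightarrow> 'w \<Rightarrow> real"
    and DE :: "('o, 'm, 'w, 'e) operators"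
    and DK :: "('o, 'm, 'w, 'k) operators"
    and U :: "('m \<times> 'w) set"
  assumes "semi_Montel s p"
    and "generator s p \<omega> \<nu> DE DK"
    and "strong s p \<omega> \<nu> DE DK"
    and "consistent s p \<omega> \<nu> DE DK"
    and "fixes_topology \<omega> \<nu> DK U"
  shows "restriction_map DE U ` (S_map \<omega> \<nu> DK ` FV_eps s p \<omega> \<nu> DK) =
    FV_dual_space_lb s p \<omega> \<nu> DK U"
proof -
  interpret consistent_strong_generator s p \<omega> \<nu> DE DK
    using assms by unfold_locales (auto simp: semi_Montel_def)
  have "U \<subseteq> Sigma UNIV \<omega>"
    using assms(5) by (simp add: fixes_topology_def)
  then show ?thesis
    using restriction_in_FV_dual_space_lb S_map_in_FV_space restriction_surjective[OF assms(1,5)]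
    by (auto simp: image_iff) metis
qed

end
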